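(* Let $R$ be a commutative noetherian ring and let $f_1,\ldots,f_r, g_1,\ldots,g_r \in R$. Let $M$ be a finitely generated $R$-module such that $\operatorname{Supp}(M/(g_1,\ldots,g_r)M) \subseteq \operatorname{Supp}(M/(f_1,\ldots,f_r)M)$. Suppose that $f_1,\ldots,f_r$ is a regular sequence on $M$. Then $g_1,\ldots,g_r$ is also a regular sequence on $M$. In particular, if $\mathrm V(g_1,\ldots,g_r) \subseteq \mathrm V(f_1,\ldots,f_r)$ in $\operatorname{Spec} R$ and if $f_1,\ldots,f_r$ is a regular sequence in $R$, then $g_1,\ldots,g_r$ is also a regular sequence in $R$.
   Context: Let $R$ be a commutative noetherian ring, $f_1,\ldots,f_r \in R$, and $M$ an $R$-module. Strongly regular sequence: $f_1,\ldots,f_r$ is a strongly regular sequence on $M$ if for every $i = 1,\ldots,r$ the element $f_i$ is a non-zero divisor for $M/(f_1,\ldots,f_{i-1})M$, i.e. multiplication by $f_i$ on this module is injective. It is not required that $M \neq (f_1,\ldots,f_r)M$; in particular every sequence is strongly regular on the zero module. Regular sequence: $f_1,\ldots,f_r$ is a regular sequence on $M$ if for every $\mathfrak p \in \operatorname{Supp}(M/(f_1,\ldots,f_r)M)$ the sequence (of images of) $f_1,\ldots,f_r$ in the local ring $R_{\mathfrak p}$ is a strongly regular sequence on the $R_{\mathfrak p}$-module $M_{\mathfrak p}$. (This is weaker than being strongly regular.) A regular sequence in $R$ means a regular sequence on the $R$-module $R$. $\operatorname{Supp}$ denotes the support of an $R$-module, and $\mathrm V(f_1,\ldots,f_r)$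 is the set of prime ideals of $R$ containing $f_1,\ldots,f_r$. *)

theory Defs
  imports "HOL-Algebra.Module" "HOL-Algebra.Ring_Divisibility"
begin

text \<open>
  The library's record of modules extends the record of rings, and the locale of modules ignores
  the multiplicative fields; they are left unspecified below.
\<close>

section \<open>Submodules and quotient modules\<close>

definition regular_module :: "('a, 'm) ring_scheme \<Rightarrow> ('a, 'a) module" where
  "regular_module R =
    \<lparr>carrier = carrier R, monoid.mult = monoid.mult R, one = one R, zero = zero R, add = add R, smult = monoid.mult R\<rparr>"

definition gen_submodule ::
  "('a, 'm) ring_scheme \<Rightarrow> ('a, 'b, 'n) module_scheme \<Rightarrow> 'b set \<Rightarrow> 'b set" where
  "gen_submodule R M X = \<Inter>{N. submodule N R M \<and> X \<subseteq> N}"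

definition fin_gen_module :: "('a, 'm) ring_scheme \<Rightarrow> ('a, 'b, 'n) module_scheme \<Rightarrow> bool" where
  "fin_gen_module R M \<longleftrightarrow>
    (\<exists>X. finite X \<and> X \<subseteq> carrier M \<and> gen_submodule R M X = carrier M)"

definition ideal_smult ::
  "('a, 'm) ring_scheme \<Rightarrow> 'a set \<Rightarrow> ('a, 'b, 'n) module_scheme \<Rightarrow> 'b set" where
  "ideal_smult R I M = gen_submodule R M {a \<odot>\<^bsub>M\<^esub> x |a x. a \<in> I \<and> x \<in> carrier M}"

definition quot_module :: "('a, 'b, 'n) module_scheme \<Rightarrow> 'b set \<Rightarrow> ('a, 'b set) module" where
  "quot_module M N =
    \<lparr>carrier = a_rcosets\<^bsub>M\<^esub> N, monoid.mult = undefined, one = undefined,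
     zero = N, add = set_add M, smult = (\<lambda>a X. \<Union>x\<in>X. N +>\<^bsub>M\<^esub> (a \<odot>\<^bsub>M\<^esub> x))\<rparr>"

definition quot_by_seq ::
  "('a, 'm) ring_scheme \<Rightarrow> ('a, 'b, 'n) module_scheme \<Rightarrow> 'a list \<Rightarrow> ('a, 'b set) module" where
  "quot_by_seq R M fs = quot_module M (ideal_smult R (genideal R (set fs)) M)"


section \<open>Localization\<close>

definition loc_rel ::
  "('a, 'b, 'n) module_scheme \<Rightarrow> 'a set \<Rightarrow> (('b \<times> 'a) \<times> ('b \<times> 'a)) set" where
  "loc_rel M S = {((x, s), (y, t)). x \<in> carrier M \<and> s \<in> S \<and> y \<in> carrier M \<and> t \<in> S \<and>
     (\<exists>u\<in>S. u \<odot>\<^bsub>M\<^esub> (t \<odot>\<^bsub>M\<^esub> x) = u \<odot>\<^bsub>M\<^esub> (s \<odot>\<^bsub>M\<^esub> y))}"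

text \<open>The fraction \<open>x / s\<close>.\<close>

definition frac_cl :: "('a, 'b, 'n) module_scheme \<Rightarrow> 'a set \<Rightarrow> 'b \<Rightarrow> 'a \<Rightarrow> ('b \<times> 'a) set" where
  "frac_cl M S x s = loc_rel M S `` {(x, s)}"

text \<open>
  As in the scalar multiplication of \<open>quot_module\<close>, the unions over representatives are unions of
  one and the same class: see \<open>quot_module_smult\<close>, \<open>loc_module_add\<close>, \<open>loc_module_smult\<close> and
  \<open>loc_ring_mult\<close>.
\<close>

definition loc_module ::
  "('a, 'm) ring_scheme \<Rightarrow> 'a set \<Rightarrow> ('a, 'b, 'n) module_scheme \<Rightarrow> (('a \<times> 'a) set, ('b \<times> 'a) set) module"
where
  "loc_module R S M =
    \<lparr>carrier = (carrier M \<times> S) // loc_rel M S, monoid.mult = undefined, one = undefined,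
     zero = frac_cl M S \<zero>\<^bsub>M\<^esub> \<one>\<^bsub>R\<^esub>,
     add = (\<lambda>X Y. \<Union>(x, s)\<in>X. \<Union>(y, t)\<in>Y.
              frac_cl M S (t \<odot>\<^bsub>M\<^esub> x \<oplus>\<^bsub>M\<^esub> s \<odot>\<^bsub>M\<^esub> y) (s \<otimes>\<^bsub>R\<^esub> t)),
     smult = (\<lambda>A X. \<Union>(a, s)\<in>A. \<Union>(x, t)\<in>X. frac_cl M S (a \<odot>\<^bsub>M\<^esub> x) (s \<otimes>\<^bsub>R\<^esub> t))\<rparr>"

definition loc_ring :: "('a, 'm) ring_scheme \<Rightarrow> 'a set \<Rightarrow> ('a \<times> 'a) set ring" where
  "loc_ring R S =
    \<lparr>carrier = carrier (loc_module R S (regular_module R)),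
     monoid.mult = smult (loc_module R S (regular_module R)),
     one = frac_cl (regular_module R) S \<one>\<^bsub>R\<^esub> \<one>\<^bsub>R\<^esub>,
     zero = zero (loc_module R S (regular_module R)),
     add = add (loc_module R S (regular_module R))\<rparr>"

definition ring_at :: "('a, 'm) ring_scheme \<Rightarrow> 'a set \<Rightarrow> ('a \<times> 'a) set ring" where
  "ring_at R P = loc_ring R (carrier R - P)"

definition module_at ::
  "('a, 'm) ring_scheme \<Rightarrow> ('a, 'b, 'n) module_scheme \<Rightarrow> 'a set \<Rightarrow> (('a \<times> 'a) set, ('b \<times> 'a) set) module"
where
  "module_at R M P = loc_module R (carrier R - P) M"

definition to_ring_at :: "('a, 'm) ring_scheme \<Rightarrow> 'a set \<Rightarrow> 'a \<Rightarrow> ('a \<times> 'a) set" where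
  "to_ring_at R P a = frac_cl (regular_module R) (carrier R - P) a \<one>\<^bsub>R\<^esub>"


section \<open>Support and regular sequences\<close>

definition Supp :: "('a, 'm) ring_scheme \<Rightarrow> ('a, 'b, 'n) module_scheme \<Rightarrow> 'a set set" where
  "Supp R M = {P. primeideal P R \<and> carrier (module_at R M P) \<noteq> {\<zero>\<^bsub>module_at R M P\<^esub>}}"

definition zero_locus :: "('a, 'm) ring_scheme \<Rightarrow> 'a list \<Rightarrow> 'a set set" where
  "zero_locus R fs = {P. primeideal P R \<and> set fs \<subseteq> P}"

text \<open>The quotient of \<open>M\<close> by the whole sequence may be zero.\<close>

definition strongly_regular_seq ::
  "('a, 'm) ring_scheme \<Rightarrow> ('a, 'b, 'n) module_scheme \<Rightarrow> 'a list \<Rightarrow> bool" where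
  "strongly_regular_seq R M fs \<longleftrightarrow>
    (\<forall>i<length fs. inj_on (\<lambda>X. fs ! i \<odot>\<^bsub>quot_by_seq R M (take i fs)\<^esub> X)
       (carrier (quot_by_seq R M (take i fs))))"

definition regular_seq ::
  "('a, 'm) ring_scheme \<Rightarrow> ('a, 'b, 'n) module_scheme \<Rightarrow> 'a list \<Rightarrow> bool" where
  "regular_seq R M fs \<longleftrightarrow>
    (\<forall>P\<in>Supp R (quot_by_seq R M fs).
       strongly_regular_seq (ring_at R P) (module_at R M P) (map (to_ring_at R P) fs))"


section \<open>The constructions yield rings and modules\<close>

lemma regular_module_simps [simp]:
  "carrier (regular_module R) = carrier R" "add (regular_module R) = add R"
  "zero (regular_module R) = zero R" "smult (regular_module R) = monoid.mult R"
  by (simp_all add: regular_module_def)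

lemma regular_module_module:
  assumes "cring R" shows "module R (regular_module R)"
proof -
  interpret cring R by fact
  have "abelian_group (regular_module R)"
    by (rule abelian_groupI) (auto simp: a_ac intro: l_neg a_inv_closed)
  then show ?thesis
    by (intro moduleI) (auto simp: assms l_distr r_distr m_assoc)
qed

context module
begin

lemma gen_submodule_submodule:
  assumes "X \<subseteq> carrier M"
  shows "submodule (gen_submodule R M X) R M"
proof -
  have "\<zero>\<^bsub>M\<^esub> \<in> N" if "submodule N R M" for N
    using subgroup.one_closed[OF submodule.axioms(1)[OF that]] by simp
  then show ?thesis
    unfolding gen_submodule_def using carrier_is_submodule assms
    by (intro submoduleI) (auto intro: submoduleE(3,4,5))
qed

lemma ideal_smult_submodule:
  assumes "I \<subseteq> carrier R"
  shows "submodule (ideal_smult R I M) R M"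
  unfolding ideal_smult_def using assms by (intro gen_submodule_submodule) auto

lemma quot_module_smult:
  assumes N: "submodule N R M" and a: "a \<in> carrier R" and x: "x \<in> carrier M"
  shows "a \<odot>\<^bsub>quot_module M N\<^esub> (N +>\<^bsub>M\<^esub> x) = N +>\<^bsub>M\<^esub> (a \<odot>\<^bsub>M\<^esub> x)"
proof -
  have sub: "subgroup N (add_monoid M)" by (rule submodule.axioms(1)[OF N])
  have "N +>\<^bsub>M\<^esub> (a \<odot>\<^bsub>M\<^esub> y) = N +>\<^bsub>M\<^esub> (a \<odot>\<^bsub>M\<^esub> x)" if y: "y \<in> N +>\<^bsub>M\<^esub> x" for y
  proof -
    obtain h where h: "h \<in> N" "y = h \<oplus>\<^bsub>M\<^esub> x" using y unfolding a_r_coset_def' by blast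
    have "h \<in> carrier M" using h(1) submoduleE(1)[OF N] by blast
    then have "a \<odot>\<^bsub>M\<^esub> y = a \<odot>\<^bsub>M\<^esub> h \<oplus>\<^bsub>M\<^esub> a \<odot>\<^bsub>M\<^esub> x"
      unfolding h(2) using a x by (intro smult_r_distr)
    moreover have "a \<odot>\<^bsub>M\<^esub> h \<in> N" using submoduleE(4)[OF N a h(1)] .
    ultimately have "a \<odot>\<^bsub>M\<^esub> y \<in> N +>\<^bsub>M\<^esub> (a \<odot>\<^bsub>M\<^esub> x)"
      unfolding a_r_coset_def' by blast
    then show ?thesis
      using M.add.repr_independence[OF _ _ sub, folded a_r_coset_def] smult_closed[OF a x] by metis
  qed
  moreover have "x \<in> N +>\<^bsub>M\<^esub> x" using M.add.rcos_self[OF x sub, folded a_r_coset_def] .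
  ultimately have "(\<Union>y\<in>N +>\<^bsub>M\<^esub> x. N +>\<^bsub>M\<^esub> (a \<odot>\<^bsub>M\<^esub> y)) = N +>\<^bsub>M\<^esub> (a \<odot>\<^bsub>M\<^esub> x)" by blast
  then show ?thesis by (simp add: quot_module_def)
qed

lemma quot_module_module:
  assumes N: "submodule N R M"
  shows "module R (quot_module M N)"
proof -
  interpret S: submodule N R M by fact
  interpret additive_subgroup N M using S.subgroup_axioms by (simp add: additive_subgroup_def)
  interpret abelian_subgroup N M by (intro abelian_subgroupI3 additive_subgroup_axioms M.abelian_group_axioms)
  have car: "carrier (quot_module M N) = (\<lambda>x. N +>\<^bsub>M\<^esub> x) ` carrier M"
    by (auto simp: quot_module_def A_RCOSETS_def')
  have add: "(N +>\<^bsub>M\<^esub> x) \<oplus>\<^bsub>quot_module M N\<^esub> (N +>\<^bsub>M\<^esub> y) = N +>\<^bsub>M\<^esub> (x \<oplus>\<^bsub>M\<^esub> y)"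
    if "x \<in> carrier M" "y \<in> carrier M" for x y
    using that by (simp add: quot_module_def a_rcos_sum)
  have ag: "abelian_group (quot_module M N)"
  proof (rule abelian_groupI)
    have zero: "\<zero>\<^bsub>quot_module M N\<^esub> = N +>\<^bsub>M\<^esub> \<zero>\<^bsub>M\<^esub>"
      using a_coset_add_zero[OF a_subset] by (simp add: quot_module_def)
    show "\<zero>\<^bsub>quot_module M N\<^esub> \<in> carrier (quot_module M N)" by (auto simp: car zero)
    fix X assume "X \<in> carrier (quot_module M N)"
    then obtain x where x: "X = N +>\<^bsub>M\<^esub> x" "x \<in> carrier M" by (auto simp: car)
    show "\<zero>\<^bsub>quot_module M N\<^esub> \<oplus>\<^bsub>quot_module M N\<^esub> X = X" using x by (simp add: zero add)
    have "(N +>\<^bsub>M\<^esub> (\<ominus>\<^bsub>M\<^esub> x)) \<oplus>\<^bsub>quot_module M N\<^esub> X = \<zero>\<^bsub>quot_module M N\<^esub>"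
      using x by (simp add: zero add M.l_neg)
    then show "\<exists>Y\<in>carrier (quot_module M N). Y \<oplus>\<^bsub>quot_module M N\<^esub> X = \<zero>\<^bsub>quot_module M N\<^esub>"
      using x by (auto simp: car)
  qed (auto simp: car add M.a_ac)
  show ?thesis
    by (intro moduleI ag)
      (auto simp: car add quot_module_smult[OF N] R.is_cring smult_l_distr smult_r_distr smult_assoc1)
qed

end

locale localization = module + submonoid S R for S
begin

lemma S_carrier: "s \<in> S \<Longrightarrow> s \<in> carrier R" using subset by auto

lemma equiv_loc_rel: "equiv (carrier M \<times> S) (loc_rel M S)"
proof (rule equivI)
  show "loc_rel M S \<subseteq> (carrier M \<times> S) \<times> (carrier M \<times> S)" by (auto simp: loc_rel_def)
  show "refl_on (carrier M \<times> S) (loc_rel M S)"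
    by (auto simp: refl_on_def loc_rel_def intro: one_closed)
  show "sym (loc_rel M S)" by (rule symI) (force simp: loc_rel_def)
  show "trans (loc_rel M S)"
  proof (rule transI)
    fix p q r assume pq: "(p, q) \<in> loc_rel M S" and qr: "(q, r) \<in> loc_rel M S"
    obtain x s y t z w where p: "p = (x, s)" "q = (y, t)" "r = (z, w)" by (metis surj_pair)
    obtain u v where c: "x \<in> carrier M" "s \<in> S" "y \<in> carrier M" "t \<in> S" "z \<in> carrier M" "w \<in> S" "u \<in> S" "v \<in> S"
      and 1: "u \<odot>\<^bsub>M\<^esub> (t \<odot>\<^bsub>M\<^esub> x) = u \<odot>\<^bsub>M\<^esub> (s \<odot>\<^bsub>M\<^esub> y)"
      and 2: "v \<odot>\<^bsub>M\<^esub> (w \<odot>\<^bsub>M\<^esub> y) = v \<odot>\<^bsub>M\<^esub> (t \<odot>\<^bsub>M\<^esub> z)"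
      using pq qr unfolding p loc_rel_def by blast
    note cc = c c(2,4,6-8)[THEN S_carrier]
    have "(u \<otimes> v \<otimes> t) \<odot>\<^bsub>M\<^esub> (w \<odot>\<^bsub>M\<^esub> x) = (v \<otimes> w) \<odot>\<^bsub>M\<^esub> (u \<odot>\<^bsub>M\<^esub> (t \<odot>\<^bsub>M\<^esub> x))"
      using cc by (simp add: smult_assoc1[symmetric] R.m_ac)
    also have "\<dots> = (u \<otimes> s) \<odot>\<^bsub>M\<^esub> (v \<odot>\<^bsub>M\<^esub> (w \<odot>\<^bsub>M\<^esub> y))"
      unfolding 1 using cc by (simp add: smult_assoc1[symmetric] R.m_ac)
    also have "\<dots> = (u \<otimes> v \<otimes> t) \<odot>\<^bsub>M\<^esub> (s \<odot>\<^bsub>M\<^esub> z)"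
      unfolding 2 using cc by (simp add: smult_assoc1[symmetric] R.m_ac)
    finally have "(u \<otimes> v \<otimes> t) \<odot>\<^bsub>M\<^esub> (w \<odot>\<^bsub>M\<^esub> x) = (u \<otimes> v \<otimes> t) \<odot>\<^bsub>M\<^esub> (s \<odot>\<^bsub>M\<^esub> z)" .
    moreover have "u \<otimes> v \<otimes> t \<in> S" using c by simp
    ultimately show "(p, r) \<in> loc_rel M S" unfolding p loc_rel_def using c by blast
  qed
qed

lemma frac_cl_eq_iff:
  assumes "x \<in> carrier M" "s \<in> S" "y \<in> carrier M" "t \<in> S"
  shows "frac_cl M S x s = frac_cl M S y t \<longleftrightarrow>
    (\<exists>u\<in>S. u \<odot>\<^bsub>M\<^esub> (t \<odot>\<^bsub>M\<^esub> x) = u \<odot>\<^bsub>M\<^esub> (s \<odot>\<^bsub>M\<^esub> y))"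
  using assms eq_equiv_class_iff[OF equiv_loc_rel, of "(x,s)" "(y,t)"]
  unfolding frac_cl_def by (auto simp: loc_rel_def)

lemma mem_frac_cl:
  assumes "p \<in> frac_cl M S x s"
  obtains y t u where "p = (y, t)" "x \<in> carrier M" "s \<in> S" "y \<in> carrier M" "t \<in> S" "u \<in> S"
    "u \<odot>\<^bsub>M\<^esub> (t \<odot>\<^bsub>M\<^esub> x) = u \<odot>\<^bsub>M\<^esub> (s \<odot>\<^bsub>M\<^esub> y)"
  using assms by (auto simp: frac_cl_def loc_rel_def)

lemma frac_cl_self: "x \<in> carrier M \<Longrightarrow> s \<in> S \<Longrightarrow> (x, s) \<in> frac_cl M S x s"
  by (auto simp: frac_cl_def loc_rel_def intro: one_closed)

lemma loc_module_carrier: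
  "carrier (loc_module R S M) = {frac_cl M S x s |x s. x \<in> carrier M \<and> s \<in> S}"
  by (auto simp: loc_module_def quotient_def frac_cl_def)

lemma UN_const2:
  assumes "p \<in> X" "q \<in> Y" "\<And>x s y t. (x, s) \<in> X \<Longrightarrow> (y, t) \<in> Y \<Longrightarrow> f x s y t = c"
  shows "(\<Union>(x, s)\<in>X. \<Union>(y, t)\<in>Y. f x s y t) = c"
proof -
  have "(\<Union>(x, s)\<in>X. \<Union>(y, t)\<in>Y. f x s y t) = (\<Union>a\<in>X. \<Union>b\<in>Y. c)"
    using assms(3) by (intro SUP_cong refl) (auto split: prod.split)
  then show ?thesis using assms(1,2) by auto
qed

lemma loc_module_add:
  assumes c: "x \<in> carrier M" "s \<in> S" "y \<in> carrier M" "t \<in> S"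
  shows "frac_cl M S x s \<oplus>\<^bsub>loc_module R S M\<^esub> frac_cl M S y t =
    frac_cl M S (t \<odot>\<^bsub>M\<^esub> x \<oplus>\<^bsub>M\<^esub> s \<odot>\<^bsub>M\<^esub> y) (s \<otimes> t)"
proof -
  have "frac_cl M S (t' \<odot>\<^bsub>M\<^esub> x' \<oplus>\<^bsub>M\<^esub> s' \<odot>\<^bsub>M\<^esub> y') (s' \<otimes> t') =
      frac_cl M S (t \<odot>\<^bsub>M\<^esub> x \<oplus>\<^bsub>M\<^esub> s \<odot>\<^bsub>M\<^esub> y) (s \<otimes> t)"
    if p: "(x', s') \<in> frac_cl M S x s" and q: "(y', t') \<in> frac_cl M S y t" for x' s' y' t'
  proof -
    from p obtain u where u: "x' \<in> carrier M" "s' \<in> S" "u \<in> S"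
      "u \<odot>\<^bsub>M\<^esub> (s' \<odot>\<^bsub>M\<^esub> x) = u \<odot>\<^bsub>M\<^esub> (s \<odot>\<^bsub>M\<^esub> x')" by (auto elim: mem_frac_cl)
    from q obtain v where v: "y' \<in> carrier M" "t' \<in> S" "v \<in> S"
      "v \<odot>\<^bsub>M\<^esub> (t' \<odot>\<^bsub>M\<^esub> y) = v \<odot>\<^bsub>M\<^esub> (t \<odot>\<^bsub>M\<^esub> y')" by (auto elim: mem_frac_cl)
    note cc = c u(1-3) v(1-3) c(2,4)[THEN S_carrier] u(2,3)[THEN S_carrier] v(2,3)[THEN S_carrier]
    have "(u \<otimes> v) \<odot>\<^bsub>M\<^esub> ((s \<otimes> t) \<odot>\<^bsub>M\<^esub> (t' \<odot>\<^bsub>M\<^esub> x' \<oplus>\<^bsub>M\<^esub> s' \<odot>\<^bsub>M\<^esub> y')) =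
        (v \<otimes> t \<otimes> t') \<odot>\<^bsub>M\<^esub> (u \<odot>\<^bsub>M\<^esub> (s \<odot>\<^bsub>M\<^esub> x')) \<oplus>\<^bsub>M\<^esub> (u \<otimes> s \<otimes> s') \<odot>\<^bsub>M\<^esub> (v \<odot>\<^bsub>M\<^esub> (t \<odot>\<^bsub>M\<^esub> y'))"
      using cc by (simp add: smult_r_distr smult_assoc1[symmetric] R.m_ac)
    also have "\<dots> = (u \<otimes> v) \<odot>\<^bsub>M\<^esub> ((s' \<otimes> t') \<odot>\<^bsub>M\<^esub> (t \<odot>\<^bsub>M\<^esub> x \<oplus>\<^bsub>M\<^esub> s \<odot>\<^bsub>M\<^esub> y))"
      unfolding u(4)[symmetric] v(4)[symmetric]
      using cc by (simp add: smult_r_distr smult_assoc1[symmetric] R.m_ac)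
    finally show ?thesis using cc by (subst frac_cl_eq_iff) auto
  qed
  then show ?thesis unfolding loc_module_def using c
    by (simp, intro UN_const2[OF frac_cl_self frac_cl_self]) auto
qed

lemma loc_module_smult:
  assumes c: "a \<in> carrier R" "s \<in> S" "x \<in> carrier M" "t \<in> S"
  shows "frac_cl (regular_module R) S a s \<odot>\<^bsub>loc_module R S M\<^esub> frac_cl M S x t =
    frac_cl M S (a \<odot>\<^bsub>M\<^esub> x) (s \<otimes> t)"
proof -
  interpret L: localization R "regular_module R" S
    using regular_module_module[OF R.is_cring] submonoid_axioms by (simp add: localization_def)
  have "frac_cl M S (a' \<odot>\<^bsub>M\<^esub> x') (s' \<otimes> t') = frac_cl M S (a \<odot>\<^bsub>M\<^esub> x) (s \<otimes> t)"
    if p: "(a', s') \<in> frac_cl (regular_module R) S a s" and q: "(x', t') \<in> frac_cl M S x t"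
    for a' s' x' t'
  proof -
    from p obtain u where u: "a' \<in> carrier R" "s' \<in> S" "u \<in> S"
      "u \<otimes> (s' \<otimes> a) = u \<otimes> (s \<otimes> a')" by (auto elim: L.mem_frac_cl)
    from q obtain v where v: "x' \<in> carrier M" "t' \<in> S" "v \<in> S"
      "v \<odot>\<^bsub>M\<^esub> (t' \<odot>\<^bsub>M\<^esub> x) = v \<odot>\<^bsub>M\<^esub> (t \<odot>\<^bsub>M\<^esub> x')" by (auto elim: mem_frac_cl)
    note cc = c u(1-3) v(1-3) c(2,4)[THEN S_carrier] u(2,3)[THEN S_carrier] v(2,3)[THEN S_carrier]
    have "(u \<otimes> v) \<odot>\<^bsub>M\<^esub> ((s \<otimes> t) \<odot>\<^bsub>M\<^esub> (a' \<odot>\<^bsub>M\<^esub> x')) =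
        (u \<otimes> (s \<otimes> a')) \<odot>\<^bsub>M\<^esub> (v \<odot>\<^bsub>M\<^esub> (t \<odot>\<^bsub>M\<^esub> x'))"
      using cc by (simp add: smult_assoc1[symmetric] R.m_ac)
    also have "\<dots> = (u \<otimes> v) \<odot>\<^bsub>M\<^esub> ((s' \<otimes> t') \<odot>\<^bsub>M\<^esub> (a \<odot>\<^bsub>M\<^esub> x))"
      unfolding u(4)[symmetric] v(4)[symmetric]
      using cc by (simp add: smult_assoc1[symmetric] R.m_ac)
    finally show ?thesis using cc by (subst frac_cl_eq_iff) auto
  qed
  then show ?thesis unfolding loc_module_def using c
    by (simp, intro UN_const2[OF L.frac_cl_self frac_cl_self]) auto
qed

lemma loc_module_zero: "\<zero>\<^bsub>loc_module R S M\<^esub> = frac_cl M S \<zero>\<^bsub>M\<^esub> \<one>"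
  by (simp add: loc_module_def)

lemma frac_cl_eqI:
  assumes "x \<in> carrier M" "s \<in> S" "y \<in> carrier M" "t \<in> S" "t \<odot>\<^bsub>M\<^esub> x = s \<odot>\<^bsub>M\<^esub> y"
  shows "frac_cl M S x s = frac_cl M S y t"
  using assms by (subst frac_cl_eq_iff) (auto intro: bexI[OF _ one_closed])

lemmas loc_simps = loc_module_add loc_module_zero S_carrier one_closed m_closed
  smult_r_distr smult_l_distr smult_assoc1[symmetric] R.m_ac

lemma loc_module_abelian_group: "abelian_group (loc_module R S M)"
proof (rule abelian_groupI)
  show "\<zero>\<^bsub>loc_module R S M\<^esub> \<in> carrier (loc_module R S M)"
    unfolding loc_module_carrier loc_module_zero using one_closed M.zero_closed by blast
next
  fix X assume "X \<in> carrier (loc_module R S M)"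
  then obtain x s where x: "X = frac_cl M S x s" "x \<in> carrier M" "s \<in> S"
    by (auto simp: loc_module_carrier)
  show "\<zero>\<^bsub>loc_module R S M\<^esub> \<oplus>\<^bsub>loc_module R S M\<^esub> X = X"
    using x by (simp add: loc_simps)
  have "frac_cl M S (\<ominus>\<^bsub>M\<^esub> x) s \<oplus>\<^bsub>loc_module R S M\<^esub> X = \<zero>\<^bsub>loc_module R S M\<^esub>"
    using x by (simp add: loc_module_add loc_module_zero S_carrier)
      (rule frac_cl_eqI, auto simp: S_carrier smult_r_minus M.l_neg)
  moreover have "frac_cl M S (\<ominus>\<^bsub>M\<^esub> x) s \<in> carrier (loc_module R S M)"
    using x by (auto simp: loc_module_carrier)
  ultimately show "\<exists>Y\<in>carrier (loc_module R S M). Y \<oplus>\<^bsub>loc_module R S M\<^esub> X = \<zero>\<^bsub>loc_module R S M\<^esub>"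
    by blast
next
  fix X Y assume "X \<in> carrier (loc_module R S M)" "Y \<in> carrier (loc_module R S M)"
  then obtain x s y t where x: "X = frac_cl M S x s" "x \<in> carrier M" "s \<in> S"
    "Y = frac_cl M S y t" "y \<in> carrier M" "t \<in> S"
    by (auto simp: loc_module_carrier)
  show "X \<oplus>\<^bsub>loc_module R S M\<^esub> Y \<in> carrier (loc_module R S M)"
    using x by (simp add: loc_module_add S_carrier loc_module_carrier) 
      (metis M.add.m_closed S_carrier m_closed smult_closed)
  show "X \<oplus>\<^bsub>loc_module R S M\<^esub> Y = Y \<oplus>\<^bsub>loc_module R S M\<^esub> X"
    using x by (simp add: loc_simps M.a_comm)
  fix Z assume "Z \<in> carrier (loc_module R S M)"
  then obtain z w where "Z = frac_cl M S z w" "z \<in> carrier M" "w \<in> S"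
    by (auto simp: loc_module_carrier)
  then show "X \<oplus>\<^bsub>loc_module R S M\<^esub> Y \<oplus>\<^bsub>loc_module R S M\<^esub> Z = X \<oplus>\<^bsub>loc_module R S M\<^esub> (Y \<oplus>\<^bsub>loc_module R S M\<^esub> Z)"
    using x by (simp add: loc_simps M.a_ac)
qed

lemma localization_regular: "localization R (regular_module R) S"
  using regular_module_module[OF R.is_cring] submonoid_axioms by (simp add: localization_def)

lemma loc_ring_mult:
  assumes "a \<in> carrier R" "s \<in> S" "b \<in> carrier R" "t \<in> S"
  shows "frac_cl (regular_module R) S a s \<otimes>\<^bsub>loc_ring R S\<^esub> frac_cl (regular_module R) S b t =
    frac_cl (regular_module R) S (a \<otimes> b) (s \<otimes> t)"
  using localization.loc_module_smult[OF localization_regular, of a s b t] assms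
  by (simp add: loc_ring_def)

lemma loc_ring_carrier:
  "carrier (loc_ring R S) = {frac_cl (regular_module R) S a s |a s. a \<in> carrier R \<and> s \<in> S}"
  using localization.loc_module_carrier[OF localization_regular] by (simp add: loc_ring_def)

lemma loc_ring_add:
  assumes "a \<in> carrier R" "s \<in> S" "b \<in> carrier R" "t \<in> S"
  shows "frac_cl (regular_module R) S a s \<oplus>\<^bsub>loc_ring R S\<^esub> frac_cl (regular_module R) S b t =
    frac_cl (regular_module R) S (t \<otimes> a \<oplus> s \<otimes> b) (s \<otimes> t)"
  using localization.loc_module_add[OF localization_regular, of a s b t] assms
  by (simp add: loc_ring_def)

lemma loc_ring_cring: "cring (loc_ring R S)"
proof -
  interpret L: localization R "regular_module R" S by (rule localization_regular)
  let ?f = "frac_cl (regular_module R) S"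
  have one: "\<one>\<^bsub>loc_ring R S\<^esub> = ?f \<one> \<one>" by (simp add: loc_ring_def)
  have ag: "abelian_group (loc_ring R S)"
  proof -
    interpret A: abelian_group "loc_module R S (regular_module R)" by (rule L.loc_module_abelian_group)
    have "\<exists>Y\<in>carrier (loc_ring R S). Y \<oplus>\<^bsub>loc_ring R S\<^esub> X = \<zero>\<^bsub>loc_ring R S\<^esub>"
      if "X \<in> carrier (loc_ring R S)" for X
      using that A.l_neg[of X] A.a_inv_closed[of X] by (simp add: loc_ring_def)
    then show ?thesis
      by (intro abelian_groupI) (simp_all add: loc_ring_def A.a_ac)
  qed
  show ?thesis
  proof (rule cringI[OF ag])
    show "comm_monoid (loc_ring R S)"
    proof (rule comm_monoidI)
      show "\<one>\<^bsub>loc_ring R S\<^esub> \<in> carrier (loc_ring R S)"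
        unfolding one loc_ring_carrier using one_closed R.one_closed by blast
    next
      fix X Y assume "X \<in> carrier (loc_ring R S)" "Y \<in> carrier (loc_ring R S)"
      then obtain x s y t where x: "X = ?f x s" "x \<in> carrier R" "s \<in> S"
        "Y = ?f y t" "y \<in> carrier R" "t \<in> S" by (auto simp: loc_ring_carrier)
      show "X \<otimes>\<^bsub>loc_ring R S\<^esub> Y \<in> carrier (loc_ring R S)"
        using x by (auto simp: loc_ring_mult loc_ring_carrier)
      show "X \<otimes>\<^bsub>loc_ring R S\<^esub> Y = Y \<otimes>\<^bsub>loc_ring R S\<^esub> X"
        using x by (simp add: loc_ring_mult S_carrier R.m_comm)
      fix Z assume "Z \<in> carrier (loc_ring R S)"
      then obtain z w where "Z = ?f z w" "z \<in> carrier R" "w \<in> S" by (auto simp: loc_ring_carrier)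
      then show "X \<otimes>\<^bsub>loc_ring R S\<^esub> Y \<otimes>\<^bsub>loc_ring R S\<^esub> Z = X \<otimes>\<^bsub>loc_ring R S\<^esub> (Y \<otimes>\<^bsub>loc_ring R S\<^esub> Z)"
        using x by (simp add: loc_ring_mult S_carrier R.m_assoc)
    qed (auto simp: one loc_ring_carrier loc_ring_mult S_carrier)
    fix X Y Z assume "X \<in> carrier (loc_ring R S)" "Y \<in> carrier (loc_ring R S)" "Z \<in> carrier (loc_ring R S)"
    then obtain x s y t z w where x: "X = ?f x s" "x \<in> carrier R" "s \<in> S"
      "Y = ?f y t" "y \<in> carrier R" "t \<in> S" "Z = ?f z w" "z \<in> carrier R" "w \<in> S"
      by (auto simp: loc_ring_carrier)
    then show "(X \<oplus>\<^bsub>loc_ring R S\<^esub> Y) \<otimes>\<^bsub>loc_ring R S\<^esub> Z =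
        X \<otimes>\<^bsub>loc_ring R S\<^esub> Z \<oplus>\<^bsub>loc_ring R S\<^esub> Y \<otimes>\<^bsub>loc_ring R S\<^esub> Z"
      by (simp add: loc_ring_add loc_ring_mult S_carrier)
        (rule L.frac_cl_eqI, auto simp: S_carrier R.l_distr R.r_distr R.m_ac)
  qed
qed

lemma loc_module_module: "module (loc_ring R S) (loc_module R S M)"
proof -
  let ?f = "frac_cl (regular_module R) S"
  have one: "\<one>\<^bsub>loc_ring R S\<^esub> = ?f \<one> \<one>" by (simp add: loc_ring_def)
  show ?thesis
  proof (rule moduleI[OF loc_ring_cring loc_module_abelian_group])
    fix A X assume "A \<in> carrier (loc_ring R S)" "X \<in> carrier (loc_module R S M)"
    then obtain a s x t where a: "A = ?f a s" "a \<in> carrier R" "s \<in> S"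
      "X = frac_cl M S x t" "x \<in> carrier M" "t \<in> S"
      by (auto simp: loc_ring_carrier loc_module_carrier)
    show "A \<odot>\<^bsub>loc_module R S M\<^esub> X \<in> carrier (loc_module R S M)"
      using a by (auto simp: loc_module_smult loc_module_carrier)
    fix B assume "B \<in> carrier (loc_ring R S)"
    then obtain b w where b: "B = ?f b w" "b \<in> carrier R" "w \<in> S"
      by (auto simp: loc_ring_carrier)
    show "(A \<oplus>\<^bsub>loc_ring R S\<^esub> B) \<odot>\<^bsub>loc_module R S M\<^esub> X =
        A \<odot>\<^bsub>loc_module R S M\<^esub> X \<oplus>\<^bsub>loc_module R S M\<^esub> B \<odot>\<^bsub>loc_module R S M\<^esub> X"
      using a b by (simp add: loc_ring_add loc_module_smult loc_module_add S_carrier)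
        (rule frac_cl_eqI, auto simp: S_carrier smult_l_distr smult_r_distr smult_assoc1[symmetric] R.m_ac)
    show "(A \<otimes>\<^bsub>loc_ring R S\<^esub> B) \<odot>\<^bsub>loc_module R S M\<^esub> X =
        A \<odot>\<^bsub>loc_module R S M\<^esub> (B \<odot>\<^bsub>loc_module R S M\<^esub> X)"
      using a b by (simp add: loc_ring_mult loc_module_smult S_carrier smult_assoc1 R.m_assoc)
  next
    fix A X Y assume "A \<in> carrier (loc_ring R S)" "X \<in> carrier (loc_module R S M)" "Y \<in> carrier (loc_module R S M)"
    then obtain a s x t y w where a: "A = ?f a s" "a \<in> carrier R" "s \<in> S"
      "X = frac_cl M S x t" "x \<in> carrier M" "t \<in> S" "Y = frac_cl M S y w" "y \<in> carrier M" "w \<in> S"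
      by (auto simp: loc_ring_carrier loc_module_carrier)
    then show "A \<odot>\<^bsub>loc_module R S M\<^esub> (X \<oplus>\<^bsub>loc_module R S M\<^esub> Y) =
        A \<odot>\<^bsub>loc_module R S M\<^esub> X \<oplus>\<^bsub>loc_module R S M\<^esub> A \<odot>\<^bsub>loc_module R S M\<^esub> Y"
      by (simp add: loc_module_smult loc_module_add S_carrier)
        (rule frac_cl_eqI, auto simp: S_carrier smult_l_distr smult_r_distr smult_assoc1[symmetric] R.m_ac)
  qed (auto simp: one loc_module_carrier loc_module_smult S_carrier)
qed

end

lemma primeideal_submonoid:
  assumes "primeideal P R"
  shows "submonoid (carrier R - P) R"
proof -
  interpret primeideal P R by fact
  show ?thesis
    using I_prime one_imp_carrier I_notcarr by (unfold_locales) auto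
qed

end

theory Submission
  imports Defs
begin

text \<open>
  Localization at a prime \<open>P\<close> is replaced by saturation of submodules of \<open>M\<close> at \<open>P\<close>. In this language
  regular sequences of elements of \<open>P\<close> may be permuted, by Nakayama's lemma. The hypothesis on the
  supports says that a power of every \<open>f\<^sub>i\<close> maps each given element of \<open>M\<close> into \<open>(g\<^sub>1, \<dots>, g\<^sub>r) M\<close>. By prime
  avoidance some \<open>y\<close> in \<open>g\<^sub>1 + (g\<^sub>2, \<dots>, g\<^sub>r)\<close> is a nonzerodivisor modulo \<open>(f\<^sub>1, \<dots>, f\<^sub>r\<^sub>-\<^sub>1) M\<close>. Then
  \<open>y, f\<^sub>1, \<dots>, f\<^sub>r\<^sub>-\<^sub>1\<close> is regular, so by induction modulo \<open>y\<close> the sequence \<open>y, g\<^sub>2, \<dots>, g\<^sub>r\<close> is regular. With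
  \<open>y\<close> moved to the end it may be replaced by \<open>g\<^sub>1\<close>, which acts in the same way modulo \<open>(g\<^sub>2, \<dots>, g\<^sub>r) M\<close>.
\<close>

section \<open>Generated submodules\<close>

text \<open>Everything stays inside one module \<open>M\<close>: a quotient is recorded by a
  submodule \<open>N\<close> and a localization by \<open>sat\<close>, so passing to
  \<open>M\<close> modulo \<open>y\<close>, or to another prime, changes neither the ring nor a
  type. This matters because the claim at \<open>P\<close> is decided at other primes as well,
  namely at the maximal annihilators, which lie inside \<open>P\<close>. The element
  \<open>f\<^sub>r\<close> never enters the new sequence. As a nonzerodivisor modulo its
  predecessors it lies outside every prime to be avoided; it serves only to show that these primes
  do not contain all of \<open>g\<^sub>1, ..., g\<^sub>r\<close>. Hence both sequences become one
  shorter in the induction. The inclusion of supports speaks about all primes and is therefore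
  traded once for the elementwise statement on powers. That statement survives the induction,
  because \<open>y, g\<^sub>2, ..., g\<^sub>r\<close> and \<open>g\<^sub>1, ..., g\<^sub>r\<close>
  generate the same ideal. Choosing \<open>y\<close> in a coset, and not merely in the ideal of all
  the \<open>g\<^sub>i\<close>, is what allows the return from \<open>y\<close> to
  \<open>g\<^sub>1\<close>.\<close>

context module
begin

abbreviation gen :: "'c set \<Rightarrow> 'c set" where
  "gen X \<equiv> gen_submodule R M X"

lemma submodule_zero: "submodule N R M \<Longrightarrow> \<zero>\<^bsub>M\<^esub> \<in> N"
  using subgroup.one_closed[OF submodule.axioms(1)] by fastforce

lemma submodule_diff: "submodule N R M \<Longrightarrow> x \<in> N \<Longrightarrow> y \<in> N \<Longrightarrow> x \<ominus>\<^bsub>M\<^esub> y \<in> N"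
  by (simp add: a_minus_def submoduleE(3,5))

lemma submodule_add_cancel:
  assumes "submodule N R M" "x \<oplus>\<^bsub>M\<^esub> y \<in> N" "x \<in> N" "y \<in> carrier M"
  shows "y \<in> N"
proof -
  have x: "x \<in> carrier M" using submoduleE(1)[OF assms(1)] assms(3) by blast
  have "(x \<oplus>\<^bsub>M\<^esub> y) \<ominus>\<^bsub>M\<^esub> x = y"
    using x assms(4) by (simp add: a_minus_def M.a_comm[of x y] M.a_assoc M.r_neg)
  then show ?thesis using submodule_diff[OF assms(1,2,3)] by simp
qed

lemma smult_diff_distr:
  "a \<in> carrier R \<Longrightarrow> b \<in> carrier R \<Longrightarrow> x \<in> carrier M \<Longrightarrow>
    (a \<ominus> b) \<odot>\<^bsub>M\<^esub> x = a \<odot>\<^bsub>M\<^esub> x \<ominus>\<^bsub>M\<^esub> b \<odot>\<^bsub>M\<^esub> x"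
  by (simp add: a_minus_def smult_l_distr smult_l_minus)

lemma smult_smult_comm:
  "a \<in> carrier R \<Longrightarrow> b \<in> carrier R \<Longrightarrow> x \<in> carrier M \<Longrightarrow>
    a \<odot>\<^bsub>M\<^esub> (b \<odot>\<^bsub>M\<^esub> x) = b \<odot>\<^bsub>M\<^esub> (a \<odot>\<^bsub>M\<^esub> x)"
  by (simp add: smult_assoc1[symmetric] R.m_comm)

lemma submodule_Int:
  assumes "submodule N R M" "submodule K R M"
  shows "submodule (N \<inter> K) R M"
proof (rule submoduleI)
  show "N \<inter> K \<subseteq> carrier M" using submoduleE(1)[OF assms(1)] by blast
qed (simp_all add: submodule_zero submoduleE(3-5) assms)

lemma gen_superset: "X \<subseteq> gen X"
  by (auto simp: gen_submodule_def)

lemma gen_least: "submodule N R M \<Longrightarrow> X \<subseteq> N \<Longrightarrow> gen X \<subseteq> N"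
  by (auto simp: gen_submodule_def)

lemma gen_closed: "X \<subseteq> carrier M \<Longrightarrow> gen X \<subseteq> carrier M"
  by (rule gen_least[OF carrier_is_submodule])

lemma gen_mono: "X \<subseteq> gen Y \<Longrightarrow> Y \<subseteq> carrier M \<Longrightarrow> gen X \<subseteq> gen Y"
  by (rule gen_least[OF gen_submodule_submodule])

text \<open>This is N + Ix. It serves with a proper ideal in Nakayama's lemma and with the unit
  ideal when one generator is added.\<close>

lemma submodule_add_multiples:
  assumes N: "submodule N R M" and I: "ideal I R" and x: "x \<in> carrier M"
  shows "submodule {n \<oplus>\<^bsub>M\<^esub> a \<odot>\<^bsub>M\<^esub> x | n a. n \<in> N \<and> a \<in> I} R M" (is "submodule ?T R M")
proof -
  interpret I: ideal I R by fact
  note Nc = subsetD[OF submoduleE(1)[OF N]] and Ic = I.Icarr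
  show ?thesis
  proof (rule submoduleI)
    show "?T \<subseteq> carrier M" using Nc Ic x by auto
    show "\<zero>\<^bsub>M\<^esub> \<in> ?T"
      using submodule_zero[OF N] I.zero_closed x
      by (intro CollectI exI[of _ "\<zero>\<^bsub>M\<^esub>"] exI[of _ \<zero>]) simp
  next
    fix y assume "y \<in> ?T"
    then obtain n a where y: "y = n \<oplus>\<^bsub>M\<^esub> a \<odot>\<^bsub>M\<^esub> x" "n \<in> N" "a \<in> I" by blast
    then have "\<ominus>\<^bsub>M\<^esub> y = \<ominus>\<^bsub>M\<^esub> n \<oplus>\<^bsub>M\<^esub> (\<ominus> a) \<odot>\<^bsub>M\<^esub> x"
      using Nc Ic x by (simp add: M.minus_add smult_l_minus)
    then show "\<ominus>\<^bsub>M\<^esub> y \<in> ?T" using y submoduleE(3)[OF N] I.a_inv_closed by blast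
  next
    fix y z assume "y \<in> ?T" "z \<in> ?T"
    then obtain n a m b where y: "y = n \<oplus>\<^bsub>M\<^esub> a \<odot>\<^bsub>M\<^esub> x" "n \<in> N" "a \<in> I"
      "z = m \<oplus>\<^bsub>M\<^esub> b \<odot>\<^bsub>M\<^esub> x" "m \<in> N" "b \<in> I" by blast
    then have "y \<oplus>\<^bsub>M\<^esub> z = (n \<oplus>\<^bsub>M\<^esub> m) \<oplus>\<^bsub>M\<^esub> (a \<oplus> b) \<odot>\<^bsub>M\<^esub> x"
      using Nc Ic x by (simp add: smult_l_distr M.a_ac)
    then show "y \<oplus>\<^bsub>M\<^esub> z \<in> ?T" using y submoduleE(5)[OF N] I.a_closed by blast
  next
    fix c y assume c: "c \<in> carrier R" and "y \<in> ?T"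
    then obtain n a where y: "y = n \<oplus>\<^bsub>M\<^esub> a \<odot>\<^bsub>M\<^esub> x" "n \<in> N" "a \<in> I" by blast
    then have "c \<odot>\<^bsub>M\<^esub> y = c \<odot>\<^bsub>M\<^esub> n \<oplus>\<^bsub>M\<^esub> (c \<otimes> a) \<odot>\<^bsub>M\<^esub> x"
      using Nc Ic x c by (simp add: smult_r_distr smult_assoc1)
    then show "c \<odot>\<^bsub>M\<^esub> y \<in> ?T" using y c submoduleE(4)[OF N] I.I_l_closed by blast
  qed
qed

text \<open>Only the elements of \<open>X\<close> are multiplied, not those of the submodule they
  generate, so that the induction in \<open>nakayama\<close> can remove one generator at a
  time.\<close>

definition ideal_multiples :: "'a set \<Rightarrow> 'c set \<Rightarrow> 'c set" where
  "ideal_multiples I X = {a \<odot>\<^bsub>M\<^esub> x | a x. a \<in> I \<and> x \<in> X}"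

lemma ideal_multiples_closed: "I \<subseteq> carrier R \<Longrightarrow> X \<subseteq> carrier M \<Longrightarrow> ideal_multiples I X \<subseteq> carrier M"
  by (auto simp: ideal_multiples_def)

lemma gen_insert_multiples:
  assumes N: "N \<subseteq> carrier M" and I: "ideal I R" and X: "X \<subseteq> carrier M" and x: "x \<in> carrier M"
    and y: "y \<in> gen (N \<union> ideal_multiples I (insert x X))"
  obtains n a where "n \<in> gen (N \<union> ideal_multiples I X)" "a \<in> I" "y = n \<oplus>\<^bsub>M\<^esub> a \<odot>\<^bsub>M\<^esub> x"
proof -
  interpret I: ideal I R by fact
  let ?G = "gen (N \<union> ideal_multiples I X)"
  have c: "N \<union> ideal_multiples I X \<subseteq> carrier M"
    using N ideal_multiples_closed[OF I.a_subset X] by blast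
  have G: "submodule ?G R M" by (rule gen_submodule_submodule[OF c])
  have "N \<union> ideal_multiples I (insert x X) \<subseteq> {n \<oplus>\<^bsub>M\<^esub> a \<odot>\<^bsub>M\<^esub> x | n a. n \<in> ?G \<and> a \<in> I}"
  proof
    fix z assume "z \<in> N \<union> ideal_multiples I (insert x X)"
    then consider "z \<in> N \<union> ideal_multiples I X" | a where "a \<in> I" "z = a \<odot>\<^bsub>M\<^esub> x"
      by (auto simp: ideal_multiples_def)
    then show "z \<in> {n \<oplus>\<^bsub>M\<^esub> a \<odot>\<^bsub>M\<^esub> x | n a. n \<in> ?G \<and> a \<in> I}"
    proof cases
      case 1
      then have "z \<in> ?G" "z = z \<oplus>\<^bsub>M\<^esub> \<zero> \<odot>\<^bsub>M\<^esub> x"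
        using subsetD[OF gen_superset] c x by auto
      then show ?thesis using I.zero_closed by blast
    next
      case 2
      then have "z = \<zero>\<^bsub>M\<^esub> \<oplus>\<^bsub>M\<^esub> a \<odot>\<^bsub>M\<^esub> x" using x I.Icarr by simp
      then show ?thesis using 2 submodule_zero[OF G] by blast
    qed
  qed
  then have "y \<in> {n \<oplus>\<^bsub>M\<^esub> a \<odot>\<^bsub>M\<^esub> x | n a. n \<in> ?G \<and> a \<in> I}"
    using gen_least[OF submodule_add_multiples[OF G I x]] y by blast
  then show ?thesis using that by blast
qed

lemma gen_insert:
  assumes X: "X \<subseteq> carrier M" and x: "x \<in> carrier M" and y: "y \<in> gen (insert x X)"
  obtains n a where "n \<in> gen X" "a \<in> carrier R" "y = n \<oplus>\<^bsub>M\<^esub> a \<odot>\<^bsub>M\<^esub> x"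
proof -
  have G: "submodule (gen X) R M" by (rule gen_submodule_submodule[OF X])
  have "\<exists>n a. z = n \<oplus>\<^bsub>M\<^esub> a \<odot>\<^bsub>M\<^esub> x \<and> n \<in> gen X \<and> a \<in> carrier R" if "z \<in> insert x X" for z
  proof (cases "z \<in> X")
    case True
    then show ?thesis using gen_superset[of X] X x
      by (intro exI[of _ z] exI[of _ \<zero>]) auto
  next
    case False
    then show ?thesis using that x submodule_zero[OF G]
      by (intro exI[of _ "\<zero>\<^bsub>M\<^esub>"] exI[of _ \<one>]) auto
  qed
  then have "insert x X \<subseteq> {n \<oplus>\<^bsub>M\<^esub> a \<odot>\<^bsub>M\<^esub> x | n a. n \<in> gen X \<and> a \<in> carrier R}" by blast
  then have "y \<in> {n \<oplus>\<^bsub>M\<^esub> a \<odot>\<^bsub>M\<^esub> x | n a. n \<in> gen X \<and> a \<in> carrier R}"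
    using gen_least[OF submodule_add_multiples[OF G R.oneideal x]] y by blast
  then show ?thesis using that by blast
qed

text \<open>The elements that \<open>a\<close> carries into the right-hand side form a submodule
  containing \<open>X\<close>. This recovers the products of \<open>I\<close> with all of
  \<open>gen X\<close> from products with generators.\<close>

lemma smult_mem_gen_multiples:
  assumes I: "ideal I R" and X: "X \<subseteq> carrier M" and N: "N \<subseteq> carrier M"
    and a: "a \<in> I" and y: "y \<in> gen X"
  shows "a \<odot>\<^bsub>M\<^esub> y \<in> gen (N \<union> ideal_multiples I X)"
proof -
  interpret I: ideal I R by fact
  let ?G = "gen (N \<union> ideal_multiples I X)"
  have c: "N \<union> ideal_multiples I X \<subseteq> carrier M"
    using N ideal_multiples_closed[OF I.a_subset X] by blast
  have G: "submodule ?G R M" by (rule gen_submodule_submodule[OF c])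
  have "submodule {z \<in> carrier M. a \<odot>\<^bsub>M\<^esub> z \<in> ?G} R M"
    using a I.Icarr submodule_zero[OF G] submoduleE(3-5)[OF G]
    by (intro submoduleI) (auto simp: smult_r_minus smult_r_distr smult_smult_comm[of a])
  moreover have "X \<subseteq> {z \<in> carrier M. a \<odot>\<^bsub>M\<^esub> z \<in> ?G}"
    using X a subsetD[OF gen_superset[of "N \<union> ideal_multiples I X"]]
    by (auto simp: ideal_multiples_def)
  ultimately show ?thesis using gen_least y by blast
qed

text \<open>The elements reached from finitely many members of \<open>Y\<close> already form a
  submodule, since two finite supports have a finite union.\<close>

lemma gen_finite_support:
  assumes Y: "Y \<subseteq> carrier M" and y: "y \<in> gen Y"
  shows "\<exists>Y0. finite Y0 \<and> Y0 \<subseteq> Y \<and> y \<in> gen Y0"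
proof -
  let ?T = "{y. \<exists>Y0. finite Y0 \<and> Y0 \<subseteq> Y \<and> y \<in> gen Y0}"
  have sub: "submodule (gen Y0) R M" if "Y0 \<subseteq> Y" for Y0
    using that Y by (intro gen_submodule_submodule) blast
  have "submodule ?T R M"
  proof (rule submoduleI)
    show "?T \<subseteq> carrier M" using submoduleE(1)[OF sub] by blast
    show "\<zero>\<^bsub>M\<^esub> \<in> ?T" using submodule_zero[OF sub] by blast
    show "\<ominus>\<^bsub>M\<^esub> x \<in> ?T" if "x \<in> ?T" for x using that submoduleE(3)[OF sub] by blast
    show "a \<odot>\<^bsub>M\<^esub> x \<in> ?T" if "a \<in> carrier R" "x \<in> ?T" for a x
      using that submoduleE(4)[OF sub] by blast
    fix x z assume "x \<in> ?T" "z \<in> ?T"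
    then obtain A B where AB: "finite A" "A \<subseteq> Y" "x \<in> gen A" "finite B" "B \<subseteq> Y" "z \<in> gen B" by blast
    have "gen A \<subseteq> gen (A \<union> B)" "gen B \<subseteq> gen (A \<union> B)"
      using AB Y gen_superset[of "A \<union> B"] by (intro gen_mono; blast)+
    then have "x \<oplus>\<^bsub>M\<^esub> z \<in> gen (A \<union> B)" using AB submoduleE(5)[OF sub] by (simp add: subset_iff)
    then show "x \<oplus>\<^bsub>M\<^esub> z \<in> ?T" using AB by blast
  qed
  moreover have "y \<in> ?T" if "y \<in> Y" for y
    using that gen_superset[of "{y}"] by (intro CollectI exI[of _ "{y}"]) auto
  ultimately have "gen Y \<subseteq> ?T" by (intro gen_least subsetI)
  then show ?thesis using y by blast
qed

end

section \<open>Finitely generated modules over noetherian rings\<close>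

context module
begin

text \<open>Induction on the generators of the ambient submodule: the part of \<open>K\<close>
  inside \<open>gen X\<close> is finitely generated by induction, and the coefficients of
  \<open>x\<close> occurring in \<open>K\<close> form a finitely generated ideal.\<close>

lemma submodule_finitely_generated:
  assumes R: "noetherian_ring R" and "finite X" "X \<subseteq> carrier M" "submodule K R M" "K \<subseteq> gen X"
  shows "\<exists>Y. finite Y \<and> Y \<subseteq> K \<and> K = gen Y"
  using assms(2-)
proof (induction X arbitrary: K)
  case empty
  then have "K \<subseteq> gen {}" "gen {} \<subseteq> K" using gen_least by auto
  then show ?case by (intro exI[of _ "{}"]) auto
next
  case (insert x X)
  note K = insert.prems(2)
  have X: "X \<subseteq> carrier M" and x: "x \<in> carrier M" using insert.prems by auto
  have GX: "submodule (gen X) R M" by (rule gen_submodule_submodule[OF X])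
  have Kc: "K \<subseteq> carrier M" by (rule submoduleE(1)[OF K])
  \<comment> \<open>The ideal of coefficients of \<open>x\<close>, kept as a function of the
    submodule so that \<open>K\<close> can be compared with the span of the chosen
    generators.\<close>
  let ?I = "\<lambda>L. {a \<in> carrier R. \<exists>n\<in>gen X. n \<oplus>\<^bsub>M\<^esub> a \<odot>\<^bsub>M\<^esub> x \<in> L}"
  have I: "ideal (?I L) R" if L: "submodule L R M" for L
  proof (rule idealI[OF R.ring_axioms])
    note c = subsetD[OF submoduleE(1)[OF GX]] x
    show "subgroup (?I L) (add_monoid R)"
    proof
      show "?I L \<subseteq> carrier (add_monoid R)" by auto
      show "\<one>\<^bsub>add_monoid R\<^esub> \<in> ?I L"
        using submodule_zero[OF L] submodule_zero[OF GX] x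
        by (intro CollectI conjI bexI[of _ "\<zero>\<^bsub>M\<^esub>"]) simp_all
    next
      fix a b assume "a \<in> ?I L" "b \<in> ?I L"
      then obtain n m where *: "a \<in> carrier R" "b \<in> carrier R" "n \<in> gen X" "m \<in> gen X"
        "n \<oplus>\<^bsub>M\<^esub> a \<odot>\<^bsub>M\<^esub> x \<in> L" "m \<oplus>\<^bsub>M\<^esub> b \<odot>\<^bsub>M\<^esub> x \<in> L" by blast
      then have "(n \<oplus>\<^bsub>M\<^esub> a \<odot>\<^bsub>M\<^esub> x) \<oplus>\<^bsub>M\<^esub> (m \<oplus>\<^bsub>M\<^esub> b \<odot>\<^bsub>M\<^esub> x) = (n \<oplus>\<^bsub>M\<^esub> m) \<oplus>\<^bsub>M\<^esub> (a \<oplus> b) \<odot>\<^bsub>M\<^esub> x"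
        using c by (simp add: smult_l_distr M.a_ac)
      moreover note submoduleE(5)[OF L *(5,6)] submoduleE(5)[OF GX *(3,4)]
      ultimately show "a \<otimes>\<^bsub>add_monoid R\<^esub> b \<in> ?I L" using * by auto
    next
      fix a assume "a \<in> ?I L"
      then obtain n where *: "a \<in> carrier R" "n \<in> gen X" "n \<oplus>\<^bsub>M\<^esub> a \<odot>\<^bsub>M\<^esub> x \<in> L" by blast
      then have "\<ominus>\<^bsub>M\<^esub> (n \<oplus>\<^bsub>M\<^esub> a \<odot>\<^bsub>M\<^esub> x) = \<ominus>\<^bsub>M\<^esub> n \<oplus>\<^bsub>M\<^esub> (\<ominus> a) \<odot>\<^bsub>M\<^esub> x"
        using c by (simp add: smult_l_minus M.minus_add)
      moreover note submoduleE(3)[OF L *(3)] submoduleE(3)[OF GX *(2)]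
      ultimately show "inv\<^bsub>add_monoid R\<^esub> a \<in> ?I L"
        using * by (auto simp: a_inv_def[symmetric])
    qed
    show *: "r \<otimes> a \<in> ?I L" if "a \<in> ?I L" "r \<in> carrier R" for a r
    proof -
      from that obtain n where *: "a \<in> carrier R" "n \<in> gen X" "n \<oplus>\<^bsub>M\<^esub> a \<odot>\<^bsub>M\<^esub> x \<in> L" by blast
      then have "r \<odot>\<^bsub>M\<^esub> (n \<oplus>\<^bsub>M\<^esub> a \<odot>\<^bsub>M\<^esub> x) = r \<odot>\<^bsub>M\<^esub> n \<oplus>\<^bsub>M\<^esub> (r \<otimes> a) \<odot>\<^bsub>M\<^esub> x"
        using c that by (simp add: smult_r_distr smult_assoc1)
      moreover note submoduleE(4)[OF L that(2) *(3)] submoduleE(4)[OF GX that(2) *(2)]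
      ultimately show ?thesis using * that(2) by auto
    qed
    show "a \<otimes> r \<in> ?I L" if "a \<in> ?I L" "r \<in> carrier R" for a r
      using *[OF that] that R.m_comm[of a r] by simp
  qed
  obtain A where A: "A \<subseteq> carrier R" "finite A" "?I K = Idl A"
    using noetherian_ring.finetely_gen[OF R I[OF K]] by blast
  have "\<forall>a\<in>A. \<exists>n. n \<in> gen X \<and> n \<oplus>\<^bsub>M\<^esub> a \<odot>\<^bsub>M\<^esub> x \<in> K"
    using R.genideal_self[OF A(1)] unfolding A(3)[symmetric] by fast
  then obtain n where n: "\<And>a. a \<in> A \<Longrightarrow> n a \<in> gen X \<and> n a \<oplus>\<^bsub>M\<^esub> a \<odot>\<^bsub>M\<^esub> x \<in> K"
    by metis
  define k where "k a = n a \<oplus>\<^bsub>M\<^esub> a \<odot>\<^bsub>M\<^esub> x" for a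
  have k: "k a \<in> K" if "a \<in> A" for a using n[OF that] by (simp add: k_def)
  obtain Y where Y: "finite Y" "Y \<subseteq> K \<inter> gen X" "K \<inter> gen X = gen Y"
    using insert.IH[OF X submodule_Int[OF K GX]] by auto
  let ?Z = "Y \<union> k ` A"
  have ZK: "?Z \<subseteq> K" using Y k by blast
  have Zc: "?Z \<subseteq> carrier M" using ZK Kc by blast
  have GZ: "submodule (gen ?Z) R M" by (rule gen_submodule_submodule[OF Zc])
  have "A \<subseteq> ?I (gen ?Z)"
  proof
    fix a assume a: "a \<in> A"
    have "k a \<in> gen ?Z" using gen_superset[of ?Z] a by blast
    then show "a \<in> ?I (gen ?Z)" using n[OF a] subsetD[OF A(1) a] by (auto simp: k_def)
  qed
  then have sub: "?I K \<subseteq> ?I (gen ?Z)"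
    unfolding A(3) by (rule R.genideal_minimal[OF I[OF GZ]])
  have "gen Y \<subseteq> gen ?Z" using gen_superset[of ?Z] Zc by (intro gen_mono) blast+
  have "K \<subseteq> gen ?Z"
  proof
    fix z assume z: "z \<in> K"
    then have "z \<in> gen (insert x X)" using insert.prems by blast
    then obtain n a where n: "n \<in> gen X" "a \<in> carrier R" "z = n \<oplus>\<^bsub>M\<^esub> a \<odot>\<^bsub>M\<^esub> x"
      using gen_insert[OF X x] by blast
    then have "a \<in> ?I K" using z by blast
    then obtain n' where "n' \<in> gen X" "n' \<oplus>\<^bsub>M\<^esub> a \<odot>\<^bsub>M\<^esub> x \<in> gen ?Z" using sub by blast
    then obtain z' where n': "z' \<in> gen ?Z" "n' \<in> gen X" "z' = n' \<oplus>\<^bsub>M\<^esub> a \<odot>\<^bsub>M\<^esub> x" by blast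
    have z': "z' \<in> K" using n'(1) gen_least[OF K ZK] by blast
    have cc: "n \<in> carrier M" "n' \<in> carrier M" "a \<odot>\<^bsub>M\<^esub> x \<in> carrier M"
      using n n' x submoduleE(1)[OF GX] by auto
    \<comment> \<open>Both elements have the same coefficient at \<open>x\<close>, so their
      difference falls into \<open>K \<inter> gen X\<close>, which \<open>Y\<close>
      generates.\<close>
    have "z \<ominus>\<^bsub>M\<^esub> z' = n \<ominus>\<^bsub>M\<^esub> n'"
      using cc unfolding n(3) n'(3)
      by (simp add: a_minus_def M.minus_add M.a_comm[of "\<ominus>\<^bsub>M\<^esub> n'"] M.a_assoc M.r_neg1 M.r_neg2)
    moreover have "n \<ominus>\<^bsub>M\<^esub> n' \<in> gen X" using submodule_diff[OF GX] n n' by blast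
    moreover have "z \<ominus>\<^bsub>M\<^esub> z' \<in> K" using submodule_diff[OF K z z'] .
    ultimately have "z \<ominus>\<^bsub>M\<^esub> z' \<in> gen ?Z" using Y \<open>gen Y \<subseteq> gen ?Z\<close> by auto
    then have "(z \<ominus>\<^bsub>M\<^esub> z') \<oplus>\<^bsub>M\<^esub> z' \<in> gen ?Z" using submoduleE(5)[OF GZ] n' by blast
    moreover have "(z \<ominus>\<^bsub>M\<^esub> z') \<oplus>\<^bsub>M\<^esub> z' = z"
      using z z' Kc by (simp add: a_minus_def M.a_assoc M.l_neg subset_iff)
    ultimately show "z \<in> gen ?Z" by simp
  qed
  then have "K = gen ?Z" using gen_least[OF K ZK] by (rule subset_antisym)
  then show ?case using ZK Y(1) A(2) by (intro exI[of _ ?Z]) simp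
qed

text \<open>The generators are found in \<open>Y\<close> itself: finitely many elements generate
  \<open>gen Y\<close>, and each of them involves only finitely many members of \<open>Y\<close>.
  This is essential when \<open>Y\<close> is not a submodule, as for the elements with maximal
  annihilator.\<close>

lemma finite_generating_subset:
  assumes R: "noetherian_ring R" and fg: "fin_gen_module R M" and Y: "Y \<subseteq> carrier M"
  shows "\<exists>Y0. finite Y0 \<and> Y0 \<subseteq> Y \<and> gen Y = gen Y0"
proof -
  obtain X where X: "finite X" "X \<subseteq> carrier M" "gen X = carrier M"
    using fg by (auto simp: fin_gen_module_def)
  obtain Z where Z: "finite Z" "Z \<subseteq> gen Y" "gen Y = gen Z"
    using submodule_finitely_generated[OF R X(1,2) gen_submodule_submodule[OF Y]] X(3) gen_closed[OF Y]
    by auto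
  have "\<exists>Y0. finite Y0 \<and> Y0 \<subseteq> Y \<and> z \<in> gen Y0" if "z \<in> Z" for z
    using gen_finite_support[OF Y] that Z by blast
  then obtain F where F: "\<And>z. z \<in> Z \<Longrightarrow> finite (F z) \<and> F z \<subseteq> Y \<and> z \<in> gen (F z)" by metis
  let ?U = "\<Union>(F ` Z)"
  have U: "?U \<subseteq> Y" "finite ?U" using F Z by auto
  have "gen (F z) \<subseteq> gen ?U" if "z \<in> Z" for z
    using that U Y gen_superset[of ?U] by (intro gen_mono) blast+
  then have "Z \<subseteq> gen ?U" using F by blast
  then have "gen Z \<subseteq> gen ?U" using U Y by (intro gen_mono) blast+
  moreover have "gen ?U \<subseteq> gen Y" using U Y gen_superset[of Y] by (intro gen_mono) blast+
  ultimately show ?thesis using U Z(3) by (intro exI[of _ ?U]) simp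
qed

end

section \<open>Saturation at a prime ideal\<close>

context module
begin

text \<open>The preimage in \<open>M\<close> of the localization of \<open>N\<close> at \<open>P\<close>.\<close>

definition sat :: "'a set \<Rightarrow> 'c set \<Rightarrow> 'c set" where
  "sat P N = {x \<in> carrier M. \<exists>s\<in>carrier R - P. s \<odot>\<^bsub>M\<^esub> x \<in> N}"

lemma prime_compl_one: "primeideal P R \<Longrightarrow> \<one> \<in> carrier R - P"
  using submonoid.one_closed[OF primeideal_submonoid] .

lemma prime_compl_mult:
  "primeideal P R \<Longrightarrow> s \<in> carrier R - P \<Longrightarrow> t \<in> carrier R - P \<Longrightarrow> s \<otimes> t \<in> carrier R - P"
  using submonoid.m_closed[OF primeideal_submonoid] .

lemma sat_superset:
  assumes "primeideal P R" "submodule N R M" shows "N \<subseteq> sat P N"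
proof
  fix x assume "x \<in> N"
  then show "x \<in> sat P N"
    using submoduleE(1)[OF assms(2)] prime_compl_one[OF assms(1)]
    by (auto simp: sat_def intro!: bexI[of _ \<one>])
qed

lemma sat_mono: "N \<subseteq> K \<Longrightarrow> sat P N \<subseteq> sat P K"
  by (auto simp: sat_def)

text \<open>A smaller prime has more denominators. This carries a hypothesis at \<open>P\<close>
  over to an annihilator prime inside \<open>P\<close>.\<close>

lemma sat_antimono: "P \<subseteq> Q \<Longrightarrow> sat Q N \<subseteq> sat P N"
  by (auto simp: sat_def)

lemma sat_submodule:
  assumes P: "primeideal P R" and N: "submodule N R M"
  shows "submodule (sat P N) R M"
proof (rule submoduleI)
  show "sat P N \<subseteq> carrier M" by (auto simp: sat_def)
  show "\<zero>\<^bsub>M\<^esub> \<in> sat P N" using sat_superset[OF assms] submodule_zero[OF N] by blast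
next
  fix x assume "x \<in> sat P N"
  then obtain s where s: "s \<in> carrier R - P" "s \<odot>\<^bsub>M\<^esub> x \<in> N" "x \<in> carrier M" by (auto simp: sat_def)
  then have "s \<odot>\<^bsub>M\<^esub> \<ominus>\<^bsub>M\<^esub> x \<in> N" using submoduleE(3)[OF N s(2)] by (simp add: smult_r_minus)
  then show "\<ominus>\<^bsub>M\<^esub> x \<in> sat P N" using s by (auto simp: sat_def)
next
  fix x y assume "x \<in> sat P N" "y \<in> sat P N"
  then obtain s t where s: "s \<in> carrier R - P" "s \<odot>\<^bsub>M\<^esub> x \<in> N" "x \<in> carrier M"
    "t \<in> carrier R - P" "t \<odot>\<^bsub>M\<^esub> y \<in> N" "y \<in> carrier M" by (auto simp: sat_def)
  then have "t \<odot>\<^bsub>M\<^esub> (s \<odot>\<^bsub>M\<^esub> x) \<oplus>\<^bsub>M\<^esub> s \<odot>\<^bsub>M\<^esub> (t \<odot>\<^bsub>M\<^esub> y) \<in> N"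
    using submoduleE(4,5)[OF N] by simp
  moreover have "t \<odot>\<^bsub>M\<^esub> (s \<odot>\<^bsub>M\<^esub> x) \<oplus>\<^bsub>M\<^esub> s \<odot>\<^bsub>M\<^esub> (t \<odot>\<^bsub>M\<^esub> y) = (s \<otimes> t) \<odot>\<^bsub>M\<^esub> (x \<oplus>\<^bsub>M\<^esub> y)"
    using s by (simp add: smult_r_distr smult_assoc1 smult_smult_comm[of t s])
  ultimately have "(s \<otimes> t) \<odot>\<^bsub>M\<^esub> (x \<oplus>\<^bsub>M\<^esub> y) \<in> N" by simp
  then show "x \<oplus>\<^bsub>M\<^esub> y \<in> sat P N"
    using s prime_compl_mult[OF P s(1,4)] unfolding sat_def by blast
next
  fix a x assume a: "a \<in> carrier R" and "x \<in> sat P N"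
  then obtain s where s: "s \<in> carrier R - P" "s \<odot>\<^bsub>M\<^esub> x \<in> N" "x \<in> carrier M" by (auto simp: sat_def)
  then have "s \<odot>\<^bsub>M\<^esub> (a \<odot>\<^bsub>M\<^esub> x) \<in> N"
    using submoduleE(4)[OF N a s(2)] a by (simp add: smult_smult_comm[of a])
  then show "a \<odot>\<^bsub>M\<^esub> x \<in> sat P N" using s a unfolding sat_def by blast
qed

text \<open>Elements outside \<open>P\<close> act like units modulo a saturated submodule; the two
  denominators are multiplied.\<close>

lemma sat_cancel:
  assumes P: "primeideal P R" and "s \<in> carrier R - P" "x \<in> carrier M" "s \<odot>\<^bsub>M\<^esub> x \<in> sat P N"
  shows "x \<in> sat P N"
proof -
  obtain t where t: "t \<in> carrier R - P" "t \<odot>\<^bsub>M\<^esub> (s \<odot>\<^bsub>M\<^esub> x) \<in> N" using assms(4) by (auto simp: sat_def)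
  then have "(t \<otimes> s) \<odot>\<^bsub>M\<^esub> x \<in> N" using assms by (simp add: smult_assoc1)
  then show ?thesis using prime_compl_mult[OF P t(1) assms(2)] assms(3) by (auto simp: sat_def)
qed

lemma sat_sat:
  assumes "primeideal P R" "submodule N R M"
  shows "sat P (sat P N) = sat P N"
  using sat_cancel[OF assms(1)] sat_superset[OF assms(1) sat_submodule[OF assms]]
  by (auto simp: sat_def[of P "sat P N"])

lemma sat_least:
  assumes "primeideal P R" "submodule N R M" "K \<subseteq> sat P N"
  shows "sat P K \<subseteq> sat P N"
  using sat_mono[OF assms(3), of P] sat_sat[OF assms(1,2)] by simp

text \<open>Elimination of generators in place of the determinant trick. A relation s x = n + a x
  with \<open>s\<close> outside \<open>P\<close> and \<open>a\<close> in \<open>P\<close> can be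
  solved for \<open>x\<close> after localization, and substituting it into the other relations
  leaves the same hypothesis for one generator fewer.\<close>

lemma nakayama:
  assumes P: "primeideal P R" and N: "submodule N R M"
    and "finite X" "X \<subseteq> carrier M" "X \<subseteq> sat P (gen (N \<union> ideal_multiples P X))"
  shows "X \<subseteq> sat P N"
  using assms(3-)
proof (induction X)
  case (insert x X)
  interpret P: primeideal P R by fact
  let ?T = "gen (N \<union> ideal_multiples P X)"
  have X: "X \<subseteq> carrier M" and x: "x \<in> carrier M" using insert.prems by auto
  have Nc: "N \<subseteq> carrier M" by (rule submoduleE(1)[OF N])
  have Tc: "N \<union> ideal_multiples P X \<subseteq> carrier M"
    using Nc ideal_multiples_closed[OF P.a_subset X] by blast
  have T: "submodule ?T R M" by (rule gen_submodule_submodule[OF Tc])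
  have sT: "submodule (sat P ?T) R M" by (rule sat_submodule[OF P T])
  have dec: "\<exists>s\<in>carrier R - P. \<exists>n\<in>?T. \<exists>a\<in>P. s \<odot>\<^bsub>M\<^esub> y = n \<oplus>\<^bsub>M\<^esub> a \<odot>\<^bsub>M\<^esub> x" if y: "y \<in> insert x X" for y
  proof -
    have "y \<in> sat P (gen (N \<union> ideal_multiples P (insert x X)))" using insert.prems y by blast
    then obtain s where "s \<in> carrier R - P" "s \<odot>\<^bsub>M\<^esub> y \<in> gen (N \<union> ideal_multiples P (insert x X))"
      by (auto simp: sat_def)
    then show ?thesis using gen_insert_multiples[OF Nc P.is_ideal X x] by metis
  qed
  have xT: "x \<in> sat P ?T"
  proof -
    obtain s n a where s: "s \<in> carrier R - P" "n \<in> ?T" "a \<in> P" "s \<odot>\<^bsub>M\<^esub> x = n \<oplus>\<^bsub>M\<^esub> a \<odot>\<^bsub>M\<^esub> x"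
      using dec[of x] by blast
    have c: "n \<in> carrier M" "a \<in> carrier R" using s submoduleE(1)[OF T] P.Icarr by auto
    \<comment> \<open>The counterpart of 1 - a being a unit for \<open>a\<close> in the maximal
      ideal of a local ring.\<close>
    have "s \<ominus> a \<notin> P"
    proof
      assume "s \<ominus> a \<in> P"
      then have "(s \<ominus> a) \<oplus> a \<in> P" using s P.a_closed by blast
      moreover have "(s \<ominus> a) \<oplus> a = s" using s c by (simp add: a_minus_def R.a_assoc R.l_neg)
      ultimately show False using s by simp
    qed
    moreover have "(s \<ominus> a) \<odot>\<^bsub>M\<^esub> x = s \<odot>\<^bsub>M\<^esub> x \<ominus>\<^bsub>M\<^esub> a \<odot>\<^bsub>M\<^esub> x"
      using s c x by (simp add: smult_diff_distr)
    then have "(s \<ominus> a) \<odot>\<^bsub>M\<^esub> x = n"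
      unfolding s(4) using c x by (simp add: a_minus_def M.a_assoc M.r_neg)
    ultimately show ?thesis using s c x by (auto simp: sat_def intro!: bexI[of _ "s \<ominus> a"])
  qed
  have "X \<subseteq> sat P ?T"
  proof
    fix y assume y: "y \<in> X"
    then obtain s n a where s: "s \<in> carrier R - P" "n \<in> ?T" "a \<in> P" "s \<odot>\<^bsub>M\<^esub> y = n \<oplus>\<^bsub>M\<^esub> a \<odot>\<^bsub>M\<^esub> x"
      using dec[of y] by blast
    \<comment> \<open>As \<open>x\<close> is already in the saturation, the summand at
      \<open>x\<close> is absorbed and \<open>x\<close> disappears from the relation for
      \<open>y\<close>.\<close>
    have "n \<in> sat P ?T" using s sat_superset[OF P T] by blast
    then have "s \<odot>\<^bsub>M\<^esub> y \<in> sat P ?T"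
      unfolding s(4) using submoduleE(4,5)[OF sT] xT s(3) P.Icarr by simp
    then show "y \<in> sat P ?T" using sat_cancel[OF P s(1)] X y by blast
  qed
  then have IH: "X \<subseteq> sat P N" using insert.IH X by blast
  have "ideal_multiples P X \<subseteq> sat P N"
    using IH submoduleE(4)[OF sat_submodule[OF P N]] P.Icarr by (auto simp: ideal_multiples_def)
  then have "?T \<subseteq> sat P N"
    using sat_superset[OF P N] by (intro gen_least[OF sat_submodule[OF P N]]) blast
  then have "sat P ?T \<subseteq> sat P N" by (rule sat_least[OF P N])
  then show ?case using xT IH by blast
qed simp

end

section \<open>Ideals in noetherian rings and prime avoidance\<close>

text \<open>Zorn's lemma applies because a nonempty chain of ideals in a noetherian ring contains
  its own union.\<close>

lemma (in noetherian_ring) ex_maximal_ideal_in: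
  assumes "\<And>I. I \<in> \<A> \<Longrightarrow> ideal I R" and I: "I \<in> \<A>"
  shows "\<exists>J\<in>\<A>. I \<subseteq> J \<and> (\<forall>K\<in>\<A>. J \<subseteq> K \<longrightarrow> K = J)"
proof -
  let ?B = "{K \<in> \<A>. I \<subseteq> K}"
  have "\<exists>J\<in>?B. \<forall>K\<in>?B. J \<subseteq> K \<longrightarrow> K = J"
  proof (rule subset_Zorn)
    fix C assume C: "subset.chain ?B C"
    show "\<exists>U\<in>?B. \<forall>X\<in>C. X \<subseteq> U"
    proof (cases "C = {}")
      case True
      then show ?thesis using I by auto
    next
      case False
      have "subset.chain {I. ideal I R} C"
        using C assms(1) unfolding pred_on.chain_def by blast
      then have "\<Union>C \<in> C" by (rule ideal_chain_is_trivial[OF False])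
      then show ?thesis using C unfolding pred_on.chain_def by (intro bexI[of _ "\<Union>C"]) auto
    qed
  qed
  then obtain J where J: "J \<in> \<A>" "I \<subseteq> J" "\<And>K. K \<in> \<A> \<Longrightarrow> I \<subseteq> K \<Longrightarrow> J \<subseteq> K \<Longrightarrow> K = J" by auto
  then have "\<forall>K\<in>\<A>. J \<subseteq> K \<longrightarrow> K = J" by (meson subset_trans)
  then show ?thesis using J by blast
qed

text \<open>Choose an element outside the prime from \<open>J\<close> and from each member of the
  family. Their product lies in all of these ideals and, by primality, still outside the
  prime.\<close>

lemma (in primeideal) Inter_not_subset:
  assumes J: "ideal J R" "\<not> J \<subseteq> I" and "finite \<A>"
    and "\<And>A. A \<in> \<A> \<Longrightarrow> ideal A R" "\<And>A. A \<in> \<A> \<Longrightarrow> \<not> A \<subseteq> I"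
  shows "\<exists>w\<in>J. w \<notin> I \<and> (\<forall>A\<in>\<A>. w \<in> A)"
  using assms(3-)
proof (induction \<A>)
  case empty
  then show ?case using J by auto
next
  case (insert A \<A>)
  have A: "ideal A R" using insert.prems by blast
  obtain w where w: "w \<in> J" "w \<notin> I" "\<forall>A\<in>\<A>. w \<in> A" using insert.IH insert.prems by auto
  obtain a where a: "a \<in> A" "a \<notin> I" using insert.prems(2) by blast
  have c: "w \<in> carrier R" "a \<in> carrier R" using ideal.Icarr[OF J(1)] ideal.Icarr[OF A] w a by auto
  have "w \<otimes> a \<notin> I" using I_prime[OF c] w a by blast
  moreover have "w \<otimes> a \<in> J" using ideal.I_r_closed[OF J(1) w(1) c(2)] .
  moreover have "w \<otimes> a \<in> A" using ideal.I_l_closed[OF A a(1) c(1)] .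
  moreover have "w \<otimes> a \<in> B" if "B \<in> \<A>" for B
  proof -
    have "ideal B R" "w \<in> B" using insert.prems w that by auto
    then show ?thesis using ideal.I_r_closed c by metis
  qed
  ultimately show ?case by (intro bexI[of _ "w \<otimes> a"]) auto
qed

text \<open>If the element found so far falls into the new prime \<open>Q\<close>, then
  \<open>J\<close> is not contained in \<open>Q\<close>, as otherwise \<open>g\<close> would be in
  \<open>Q\<close> too. Incomparability then gives some \<open>w\<close> in \<open>J\<close> and in
  all the earlier primes but not in \<open>Q\<close>; adding it repairs \<open>Q\<close> and leaves
  the others undisturbed.\<close>

lemma (in cring) coset_prime_avoidance:
  assumes g: "g \<in> carrier R" and J: "ideal J R" and "finite \<Q>"
    and "\<And>Q. Q \<in> \<Q> \<Longrightarrow> primeideal Q R" "\<And>Q Q'. Q \<in> \<Q> \<Longrightarrow> Q' \<in> \<Q> \<Longrightarrow> Q \<subseteq> Q' \<Longrightarrow> Q = Q'"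
    and "\<And>Q. Q \<in> \<Q> \<Longrightarrow> \<not> (g \<in> Q \<and> J \<subseteq> Q)"
  shows "\<exists>j\<in>J. \<forall>Q\<in>\<Q>. g \<oplus> j \<notin> Q"
  using assms(3-)
proof (induction \<Q>)
  case empty
  then show ?case using additive_subgroup.zero_closed[OF ideal.axioms(1)[OF J]] by blast
next
  case (insert Q \<Q>)
  interpret J: ideal J R by fact
  interpret Q: primeideal Q R using insert.prems(1) by blast
  have "\<exists>j\<in>J. \<forall>Q\<in>\<Q>. g \<oplus> j \<notin> Q"
    by (rule insert.IH) (use insert.prems in auto)
  then obtain j where j: "j \<in> J" "\<And>A. A \<in> \<Q> \<Longrightarrow> g \<oplus> j \<notin> A" by blast
  have jc: "j \<in> carrier R" using j(1) by (rule J.Icarr)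
  show ?case
  proof (cases "g \<oplus> j \<in> Q")
    case False
    then show ?thesis using j by auto
  next
    case True
    have "\<not> J \<subseteq> Q"
    proof
      assume sub: "J \<subseteq> Q"
      then have "(g \<oplus> j) \<oplus> \<ominus> j \<in> Q" 
        using Q.a_closed[OF True Q.a_inv_closed] j(1) by blast
      moreover have "(g \<oplus> j) \<oplus> \<ominus> j = g" using g jc by (simp add: a_assoc r_neg)
      ultimately have "g \<in> Q" by (simp only:)
      then show False using insert.prems(3)[of Q] sub by simp
    qed
    moreover have "ideal A R" if "A \<in> \<Q>" for A
      using insert.prems(1)[of A] that by (simp add: primeideal.axioms)
    moreover have "\<not> A \<subseteq> Q" if "A \<in> \<Q>" for A
      using insert.prems(2)[of A Q] insert.hyps that by auto
    ultimately obtain w where w: "w \<in> J" "w \<notin> Q" "\<And>A. A \<in> \<Q> \<Longrightarrow> w \<in> A"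
      using Q.Inter_not_subset[OF J _ insert.hyps(1)] by blast
    have wc: "w \<in> carrier R" using w(1) by (rule J.Icarr)
    have eq: "g \<oplus> (j \<oplus> w) = (g \<oplus> j) \<oplus> w" using g jc wc by (simp add: a_assoc)
    \<comment> \<open>For \<open>Q\<close>, subtracting \<open>g \<oplus> j\<close> would put
      \<open>w\<close> into \<open>Q\<close>; for an earlier prime, subtracting \<open>w\<close>
      would put \<open>g \<oplus> j\<close> into it.\<close>
    have "g \<oplus> (j \<oplus> w) \<notin> A" if A: "A \<in> insert Q \<Q>" for A
    proof
      assume a: "g \<oplus> (j \<oplus> w) \<in> A"
      interpret A: primeideal A R using insert.prems(1)[OF A] .
      show False
      proof (cases "A = Q")
        case True
        have "\<ominus> (g \<oplus> j) \<oplus> ((g \<oplus> j) \<oplus> w) \<in> Q"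

          using Q.a_closed[OF Q.a_inv_closed[OF \<open>g \<oplus> j \<in> Q\<close>]] a unfolding True eq by blast
        then show False using w(2) g jc wc by (simp add: r_neg1)
      next
        case False
        then have "A \<in> \<Q>" using A by simp
        then have "((g \<oplus> j) \<oplus> w) \<oplus> \<ominus> w \<in> A"

          using A.a_closed[OF _ A.a_inv_closed[OF w(3)]] a unfolding eq by blast
        then show False using j(2)[OF \<open>A \<in> \<Q>\<close>] g jc wc by (simp add: a_assoc r_neg)
      qed
    qed
    then show ?thesis using J.a_closed[OF j(1) w(1)] by blast
  qed
qed

section \<open>Maximal annihilators\<close>

context module
begin

text \<open>The annihilator of the class of \<open>x\<close> in M/N.\<close>

definition colon :: "'c set \<Rightarrow> 'c \<Rightarrow> 'a set" where
  "colon N x = {a \<in> carrier R. a \<odot>\<^bsub>M\<^esub> x \<in> N}"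

lemma colon_ideal:
  assumes N: "submodule N R M" and x: "x \<in> carrier M"
  shows "ideal (colon N x) R"
proof (rule idealI[OF R.ring_axioms])
  show "subgroup (colon N x) (add_monoid R)"
  proof
    fix a assume "a \<in> colon N x"
    then have "a \<in> carrier R" "\<ominus>\<^bsub>M\<^esub> (a \<odot>\<^bsub>M\<^esub> x) \<in> N" using submoduleE(3)[OF N] by (auto simp: colon_def)
    then show "inv\<^bsub>add_monoid R\<^esub> a \<in> colon N x"
      using x by (simp add: colon_def smult_l_minus flip: a_inv_def)
  qed (use x submodule_zero[OF N] submoduleE(5)[OF N] in \<open>auto simp: colon_def smult_l_distr\<close>)
next
  fix a r assume a: "a \<in> colon N x" and r: "r \<in> carrier R"
  then show "r \<otimes> a \<in> colon N x" using x submoduleE(4)[OF N] by (simp add: colon_def smult_assoc1)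
  then show "a \<otimes> r \<in> colon N x" using a r R.m_comm[of a r] by (simp add: colon_def)
qed

lemma colon_smult_superset:
  assumes "submodule N R M" "x \<in> carrier M" "a \<in> carrier R"
  shows "colon N x \<subseteq> colon N (a \<odot>\<^bsub>M\<^esub> x)"
  using assms submoduleE(4)[OF assms(1,3)] by (auto simp: colon_def smult_smult_comm[of _ a])

lemma Idl_smult_mem:
  assumes K: "submodule K R M" and "A \<subseteq> carrier R" "\<And>a x. a \<in> A \<Longrightarrow> x \<in> carrier M \<Longrightarrow> a \<odot>\<^bsub>M\<^esub> x \<in> K"
    and a: "a \<in> Idl A" and x: "x \<in> carrier M"
  shows "a \<odot>\<^bsub>M\<^esub> x \<in> K"
proof -
  have "Idl A \<subseteq> colon K x"
    using assms(2,3) x by (intro R.genideal_minimal colon_ideal K) (auto simp: colon_def)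
  then show ?thesis using a by (auto simp: colon_def)
qed

text \<open>Passing from \<open>y\<close> to a multiple can only enlarge the annihilator, so by
  maximality it stays the same as long as the multiple still avoids \<open>N\<close> under
  \<open>S\<close>. The case \<open>S = {\<one>}\<close> yields the maximal associated primes of
  M/N; the powers of an element yield the prime used to exploit the inclusion of supports.\<close>

lemma maximal_colon_prime:
  assumes S: "submonoid S R" and N: "submodule N R M"
    and y: "y \<in> carrier M" "\<forall>s\<in>S. s \<odot>\<^bsub>M\<^esub> y \<notin> N"
    and max: "\<forall>z\<in>carrier M. (\<forall>s\<in>S. s \<odot>\<^bsub>M\<^esub> z \<notin> N) \<longrightarrow> colon N y \<subseteq> colon N z
      \<longrightarrow> colon N z = colon N y"
  shows "primeideal (colon N y) R"
proof (rule primeidealI[OF colon_ideal[OF N y(1)] R.is_cring])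
  interpret S: submonoid S R by fact
  have "\<one> \<notin> colon N y" using y(2) S.one_closed unfolding colon_def by blast
  then show "carrier R \<noteq> colon N y" using R.one_closed by metis
  fix a b assume a: "a \<in> carrier R" and b: "b \<in> carrier R" and ab: "a \<otimes> b \<in> colon N y"
  show "a \<in> colon N y \<or> b \<in> colon N y"
  proof (rule disjCI)
    assume nb: "b \<notin> colon N y"
    have "s \<odot>\<^bsub>M\<^esub> (b \<odot>\<^bsub>M\<^esub> y) \<notin> N" if s: "s \<in> S" for s
    proof
      \<comment> \<open>This would place \<open>b\<close> in the annihilator of a multiple of
        \<open>y\<close> by \<open>s\<close>, which by maximality is that of
        \<open>y\<close>.\<close>
      assume *: "s \<odot>\<^bsub>M\<^esub> (b \<odot>\<^bsub>M\<^esub> y) \<in> N"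
      have sc: "s \<in> carrier R" using s S.subset by blast
      have "t \<odot>\<^bsub>M\<^esub> (s \<odot>\<^bsub>M\<^esub> y) \<notin> N" if t: "t \<in> S" for t
      proof -
        have "t \<in> carrier R" using t S.subset by blast
        then have "t \<odot>\<^bsub>M\<^esub> (s \<odot>\<^bsub>M\<^esub> y) = (t \<otimes> s) \<odot>\<^bsub>M\<^esub> y" using sc y by (simp add: smult_assoc1)
        then show ?thesis using bspec[OF y(2) S.m_closed[OF t s]] by simp
      qed
      then have "colon N (s \<odot>\<^bsub>M\<^esub> y) = colon N y"
        using max[THEN bspec, of "s \<odot>\<^bsub>M\<^esub> y"] colon_smult_superset[OF N y(1) sc] sc y(1) by simp
      moreover have "b \<in> colon N (s \<odot>\<^bsub>M\<^esub> y)"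
        using * b sc y(1) by (simp add: colon_def smult_smult_comm[of b s])
      ultimately show False using nb by simp
    qed
    then have "colon N (b \<odot>\<^bsub>M\<^esub> y) = colon N y"
      using max[THEN bspec, of "b \<odot>\<^bsub>M\<^esub> y"] colon_smult_superset[OF N y(1) b] b y(1) by simp
    moreover have "a \<in> colon N (b \<odot>\<^bsub>M\<^esub> y)"
      using ab a b y(1) by (simp add: colon_def smult_assoc1)
    ultimately show "a \<in> colon N y" by simp
  qed
qed

lemma ex_maximal_colon:
  assumes R: "noetherian_ring R" and N: "submodule N R M"
    and x: "x \<in> carrier M" "\<forall>s\<in>S. s \<odot>\<^bsub>M\<^esub> x \<notin> N"
  obtains y where "y \<in> carrier M" "\<forall>s\<in>S. s \<odot>\<^bsub>M\<^esub> y \<notin> N" "colon N x \<subseteq> colon N y"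
    "\<forall>z\<in>carrier M. (\<forall>s\<in>S. s \<odot>\<^bsub>M\<^esub> z \<notin> N) \<longrightarrow> colon N y \<subseteq> colon N z
      \<longrightarrow> colon N z = colon N y"
proof -
  let ?Y = "{y \<in> carrier M. \<forall>s\<in>S. s \<odot>\<^bsub>M\<^esub> y \<notin> N}"
  have "\<exists>J\<in>colon N ` ?Y. colon N x \<subseteq> J \<and> (\<forall>K\<in>colon N ` ?Y. J \<subseteq> K \<longrightarrow> K = J)"
    using x by (intro noetherian_ring.ex_maximal_ideal_in[OF R]) (auto intro: colon_ideal N)
  then obtain y where y: "y \<in> ?Y" "colon N x \<subseteq> colon N y"
    "\<And>z. z \<in> ?Y \<Longrightarrow> colon N y \<subseteq> colon N z \<Longrightarrow> colon N z = colon N y" by auto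
  show ?thesis by (rule that[of y]) (use y in auto)
qed

text \<open>Only the maximal annihilators among the associated primes of M/N are kept. They still
  contain all zero divisors, and their maximality supplies the incomparability required by
  \<open>coset_prime_avoidance\<close>.\<close>

lemma ex_zero_divisor_primes:
  assumes R: "noetherian_ring R" and fg: "fin_gen_module R M" and N: "submodule N R M"
  obtains \<Q> where "finite \<Q>"
    "\<And>Q. Q \<in> \<Q> \<Longrightarrow> primeideal Q R" "\<And>Q. Q \<in> \<Q> \<Longrightarrow> \<exists>y\<in>carrier M - N. Q = colon N y"
    "\<And>Q Q'. Q \<in> \<Q> \<Longrightarrow> Q' \<in> \<Q> \<Longrightarrow> Q \<subseteq> Q' \<Longrightarrow> Q = Q'"
    "\<And>x. x \<in> carrier M - N \<Longrightarrow> \<exists>Q\<in>\<Q>. colon N x \<subseteq> Q"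
proof -
  have S: "submonoid {\<one>} R" by unfold_locales auto
  let ?Y = "{y \<in> carrier M - N. \<forall>z\<in>carrier M - N. colon N y \<subseteq> colon N z \<longrightarrow> colon N z = colon N y}"
  let ?Q = "colon N ` ?Y"
  have prime: "primeideal (colon N y) R" if "y \<in> ?Y" for y
    by (rule maximal_colon_prime[OF S N]) (use that in auto)
  obtain Y0 where Y0: "finite Y0" "Y0 \<subseteq> ?Y" "gen ?Y = gen Y0"
    using finite_generating_subset[OF R fg, of ?Y] by auto
  have "?Q \<subseteq> colon N ` Y0"
  proof
    fix Q assume "Q \<in> ?Q"
    then obtain y where y: "y \<in> ?Y" "Q = colon N y" by blast
    interpret Q: primeideal Q R using prime[OF y(1)] y(2) by simp
    \<comment> \<open>Otherwise some \<open>w\<close> outside \<open>Q\<close> annihilates every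
      element of \<open>Y0\<close> modulo \<open>N\<close>, hence all that they generate, in
      particular \<open>y\<close>.\<close>
    have "\<exists>z\<in>Y0. colon N z \<subseteq> Q"
    proof (rule ccontr)
      assume neg: "\<not> (\<exists>z\<in>Y0. colon N z \<subseteq> Q)"
      have "\<not> carrier R \<subseteq> Q" using Q.I_notcarr Q.a_subset by blast
      moreover have "ideal A R" if "A \<in> colon N ` Y0" for A
        using that Y0(2) colon_ideal[OF N] by auto
      ultimately obtain w where w: "w \<in> carrier R" "w \<notin> Q" "\<forall>A\<in>colon N ` Y0. w \<in> A"
        using Q.Inter_not_subset[OF R.oneideal, of "colon N ` Y0"] Y0(1) neg by auto
      have "submodule {z \<in> carrier M. w \<odot>\<^bsub>M\<^esub> z \<in> N} R M"
        using w(1) submodule_zero[OF N] submoduleE(3-5)[OF N]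
        by (intro submoduleI) (auto simp: smult_r_minus smult_r_distr smult_smult_comm[of w])
      moreover have "Y0 \<subseteq> {z \<in> carrier M. w \<odot>\<^bsub>M\<^esub> z \<in> N}" using w(3) Y0(2) by (auto simp: colon_def)
      ultimately have "gen Y0 \<subseteq> {z \<in> carrier M. w \<odot>\<^bsub>M\<^esub> z \<in> N}" by (rule gen_least)
      moreover have "y \<in> gen Y0" unfolding Y0(3)[symmetric] using gen_superset y(1) by (rule subsetD)
      ultimately have "y \<in> {z \<in> carrier M. w \<odot>\<^bsub>M\<^esub> z \<in> N}" by (rule subsetD)
      then have "w \<in> colon N y" unfolding colon_def using w(1) by blast
      then show False using w(2) unfolding y(2) by (rule notE[rotated])
    qed
    then obtain z where z: "z \<in> Y0" "colon N z \<subseteq> Q" by blast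
    \<comment> \<open>Maximality of the annihilator of \<open>z\<close> turns the inclusion into an
      equality, so every such prime comes from the finite set \<open>Y0\<close>.\<close>
    then have "colon N y = colon N z" using Y0(2) y by auto
    then show "Q \<in> colon N ` Y0" using z y by simp
  qed
  then have "finite ?Q" using Y0(1) by (rule finite_subset[OF _ finite_imageI])
  moreover have "\<exists>Q\<in>?Q. colon N x \<subseteq> Q" if x: "x \<in> carrier M - N" for x
  proof -
    have "\<forall>s\<in>{\<one>}. s \<odot>\<^bsub>M\<^esub> x \<notin> N" using x by simp
    then obtain y where y: "y \<in> carrier M" "\<forall>s\<in>{\<one>}. s \<odot>\<^bsub>M\<^esub> y \<notin> N" "colon N x \<subseteq> colon N y"
      "\<forall>z\<in>carrier M. (\<forall>s\<in>{\<one>}. s \<odot>\<^bsub>M\<^esub> z \<notin> N) \<longrightarrow> colon N y \<subseteq> colon N z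
        \<longrightarrow> colon N z = colon N y"
      using ex_maximal_colon[OF R N, of x "{\<one>}"] x by blast
    then have "y \<in> ?Y" by simp
    then show ?thesis using y(3) by blast
  qed
  ultimately show ?thesis using prime by (intro that[of ?Q]) auto
qed

end

section \<open>Regular sequences modulo a submodule\<close>

text \<open>The accumulated submodule plays the role of successive quotients of \<open>M\<close>,
  which lets an induction modulo the head of a sequence stay in \<open>M\<close>.\<close>

primrec seq_sub :: "('a, 'b, 'n) module_scheme \<Rightarrow> 'b set \<Rightarrow> 'a list \<Rightarrow> 'b set" where
  "seq_sub M N [] = N"
| "seq_sub M N (f # fs) = seq_sub M {n \<oplus>\<^bsub>M\<^esub> f \<odot>\<^bsub>M\<^esub> x | n x. n \<in> N \<and> x \<in> carrier M} fs"

context module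
begin

lemma submodule_add_image:
  assumes N: "submodule N R M" and f: "f \<in> carrier R"
  shows "submodule {n \<oplus>\<^bsub>M\<^esub> f \<odot>\<^bsub>M\<^esub> x | n x. n \<in> N \<and> x \<in> carrier M} R M" (is "submodule ?T R M")
proof (rule submoduleI)
  note c = subsetD[OF submoduleE(1)[OF N]] f
  show "?T \<subseteq> carrier M" using c by auto
  show "\<zero>\<^bsub>M\<^esub> \<in> ?T"
    using submodule_zero[OF N] f
    by (intro CollectI exI[of _ "\<zero>\<^bsub>M\<^esub>"]) simp
next
  note c = subsetD[OF submoduleE(1)[OF N]] f
  fix y assume "y \<in> ?T"
  then obtain n x where y: "y = n \<oplus>\<^bsub>M\<^esub> f \<odot>\<^bsub>M\<^esub> x" "n \<in> N" "x \<in> carrier M" by blast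
  then have "\<ominus>\<^bsub>M\<^esub> y = \<ominus>\<^bsub>M\<^esub> n \<oplus>\<^bsub>M\<^esub> f \<odot>\<^bsub>M\<^esub> (\<ominus>\<^bsub>M\<^esub> x)"
    using c by (simp add: M.minus_add smult_r_minus)
  then show "\<ominus>\<^bsub>M\<^esub> y \<in> ?T" using submoduleE(3)[OF N y(2)] M.a_inv_closed[OF y(3)] by blast
next
  note c = subsetD[OF submoduleE(1)[OF N]] f
  fix y z assume "y \<in> ?T" "z \<in> ?T"
  then obtain n x m w where y: "y = n \<oplus>\<^bsub>M\<^esub> f \<odot>\<^bsub>M\<^esub> x" "n \<in> N" "x \<in> carrier M"
    "z = m \<oplus>\<^bsub>M\<^esub> f \<odot>\<^bsub>M\<^esub> w" "m \<in> N" "w \<in> carrier M" by blast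
  then have "y \<oplus>\<^bsub>M\<^esub> z = (n \<oplus>\<^bsub>M\<^esub> m) \<oplus>\<^bsub>M\<^esub> f \<odot>\<^bsub>M\<^esub> (x \<oplus>\<^bsub>M\<^esub> w)"
    using c by (simp add: smult_r_distr M.a_ac)
  then show "y \<oplus>\<^bsub>M\<^esub> z \<in> ?T" using submoduleE(5)[OF N y(2,5)] M.a_closed[OF y(3,6)] by blast
next
  note c = subsetD[OF submoduleE(1)[OF N]] f
  fix a y assume a: "a \<in> carrier R" and "y \<in> ?T"
  then obtain n x where y: "y = n \<oplus>\<^bsub>M\<^esub> f \<odot>\<^bsub>M\<^esub> x" "n \<in> N" "x \<in> carrier M" by blast
  then have "a \<odot>\<^bsub>M\<^esub> y = a \<odot>\<^bsub>M\<^esub> n \<oplus>\<^bsub>M\<^esub> f \<odot>\<^bsub>M\<^esub> (a \<odot>\<^bsub>M\<^esub> x)"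
    using c a by (simp add: smult_r_distr smult_smult_comm[of a f])
  then show "a \<odot>\<^bsub>M\<^esub> y \<in> ?T" using submoduleE(4)[OF N a y(2)] smult_closed[OF a y(3)] by blast
qed

lemma seq_sub_submodule:
  "submodule N R M \<Longrightarrow> set fs \<subseteq> carrier R \<Longrightarrow> submodule (seq_sub M N fs) R M"
  by (induction fs arbitrary: N) (simp_all add: submodule_add_image)

lemma seq_sub_superset:
  assumes "submodule N R M" "set fs \<subseteq> carrier R" shows "N \<subseteq> seq_sub M N fs"
  using assms
proof (induction fs arbitrary: N)
  case (Cons f fs)
  let ?T = "{n \<oplus>\<^bsub>M\<^esub> f \<odot>\<^bsub>M\<^esub> x | n x. n \<in> N \<and> x \<in> carrier M}"
  have "N \<subseteq> ?T"
  proof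
    fix n assume "n \<in> N"
    moreover then have "n = n \<oplus>\<^bsub>M\<^esub> f \<odot>\<^bsub>M\<^esub> \<zero>\<^bsub>M\<^esub>"
      using submoduleE(1)[OF Cons.prems(1)] Cons.prems(2) by auto
    ultimately show "n \<in> ?T" using M.zero_closed by blast
  qed
  also have "?T \<subseteq> seq_sub M ?T fs"
    using Cons.prems by (intro Cons.IH submodule_add_image) auto
  finally show ?case by simp
qed simp

lemma seq_sub_smult:
  assumes "submodule N R M" "set fs \<subseteq> carrier R" "f \<in> set fs" "x \<in> carrier M"
  shows "f \<odot>\<^bsub>M\<^esub> x \<in> seq_sub M N fs"
  using assms
proof (induction fs arbitrary: N)
  case (Cons g fs)
  let ?T = "{n \<oplus>\<^bsub>M\<^esub> g \<odot>\<^bsub>M\<^esub> x | n x. n \<in> N \<and> x \<in> carrier M}"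
  have T: "submodule ?T R M" using Cons.prems by (intro submodule_add_image) auto
  show ?case
  proof (cases "f = g")
    case True
    then have "f \<odot>\<^bsub>M\<^esub> x = \<zero>\<^bsub>M\<^esub> \<oplus>\<^bsub>M\<^esub> g \<odot>\<^bsub>M\<^esub> x" using Cons.prems by simp
    then have "f \<odot>\<^bsub>M\<^esub> x \<in> ?T" using submodule_zero[OF Cons.prems(1)] Cons.prems(4) by blast
    then show ?thesis using seq_sub_superset[OF T, of fs] Cons.prems(2) by auto
  next
    case False
    then show ?thesis using Cons.IH[OF T] Cons.prems by simp
  qed
qed simp

lemma seq_sub_least:
  assumes K: "submodule K R M" and "N \<subseteq> K" "\<And>f x. f \<in> set fs \<Longrightarrow> x \<in> carrier M \<Longrightarrow> f \<odot>\<^bsub>M\<^esub> x \<in> K"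
  shows "seq_sub M N fs \<subseteq> K"
  using assms(2-)
proof (induction fs arbitrary: N)
  case (Cons f fs)
  have "{n \<oplus>\<^bsub>M\<^esub> f \<odot>\<^bsub>M\<^esub> x | n x. n \<in> N \<and> x \<in> carrier M} \<subseteq> K"
    using Cons.prems submoduleE(5)[OF K] by auto
  then show ?case using Cons.IH Cons.prems(2) by simp
qed simp

lemma seq_sub_set_mono:
  assumes "submodule N R M" "set gs \<subseteq> carrier R" "set fs \<subseteq> set gs"
  shows "seq_sub M N fs \<subseteq> seq_sub M N gs"
  using assms seq_sub_superset[OF assms(1,2)] seq_sub_smult[OF assms(1,2)]
  by (intro seq_sub_least seq_sub_submodule) auto

lemma seq_sub_set_eq:
  assumes "submodule N R M" "set gs \<subseteq> carrier R" "set fs = set gs"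
  shows "seq_sub M N fs = seq_sub M N gs"
  using seq_sub_set_mono[of N gs fs] seq_sub_set_mono[of N fs gs] assms by auto

text \<open>Injectivity of \<open>f\<close> on the localization of M/N at \<open>P\<close>, tested
  on numerators.\<close>

definition nonzerodivisor :: "'a set \<Rightarrow> 'c set \<Rightarrow> 'a \<Rightarrow> bool" where
  "nonzerodivisor P N f \<longleftrightarrow> (\<forall>x\<in>carrier M. f \<odot>\<^bsub>M\<^esub> x \<in> sat P N \<longrightarrow> x \<in> sat P N)"

text \<open>Recursion from the front, so that swapping the first two entries leaves the condition on
  the tail untouched; \<open>regular_iff_nth\<close> recovers the indexed form.\<close>

primrec regular :: "'a set \<Rightarrow> 'c set \<Rightarrow> 'a list \<Rightarrow> bool" where
  "regular P N [] \<longleftrightarrow> True"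
| "regular P N (f # fs) \<longleftrightarrow> nonzerodivisor P N f \<and> regular P (seq_sub M N [f]) fs"

lemma regular_append:
  "regular P N (fs @ gs) \<longleftrightarrow> regular P N fs \<and> regular P (seq_sub M N fs) gs"
  by (induction fs arbitrary: N) simp_all

lemma regular_iff_nth:
  "regular P N fs \<longleftrightarrow> (\<forall>i<length fs. nonzerodivisor P (seq_sub M N (take i fs)) (fs ! i))"
proof (induction fs rule: rev_induct)
  case (snoc f fs)
  then show ?case by (auto simp: regular_append less_Suc_eq nth_append)
qed simp

text \<open>The first claim applies Nakayama's lemma to \<open>{x. b x \<in> N}\<close>, on which \<open>a\<close> is surjective
  modulo \<open>N\<close>.\<close>

lemma nonzerodivisor_swap:
  assumes R: "noetherian_ring R" and fg: "fin_gen_module R M" and P: "primeideal P R"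
    and N: "submodule N R M" and a: "a \<in> P" and b: "b \<in> carrier R"
    and reg: "nonzerodivisor P N a" "nonzerodivisor P (seq_sub M N [a]) b"
  shows "nonzerodivisor P N b \<and> nonzerodivisor P (seq_sub M N [b]) a"
proof -
  interpret P: primeideal P R by fact
  have ac: "a \<in> carrier R" using a by (rule P.Icarr)
  let ?L = "sat P N" and ?A = "sat P (seq_sub M N [a])" and ?B = "sat P (seq_sub M N [b])"
  have L: "submodule ?L R M" by (rule sat_submodule[OF P N])
  have Lc: "?L \<subseteq> carrier M" by (rule submoduleE(1)[OF L])
  have NL: "N \<subseteq> ?L" by (rule sat_superset[OF P N])
  have Na: "submodule (seq_sub M N [a]) R M" using ac by (intro seq_sub_submodule N) auto
  have Nb: "submodule (seq_sub M N [b]) R M" using b by (intro seq_sub_submodule N) auto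
  have A: "submodule ?A R M" by (rule sat_submodule[OF P Na])
  have B: "submodule ?B R M" by (rule sat_submodule[OF P Nb])
  have NA: "N \<subseteq> seq_sub M N [a]" using ac by (intro seq_sub_superset N) auto
  have LA: "?L \<subseteq> ?A" using NA by (rule sat_mono)
  have LB: "?L \<subseteq> ?B" using b by (intro sat_mono seq_sub_superset N) auto
  have Aex: "\<exists>s\<in>carrier R - P. \<exists>n\<in>N. \<exists>y\<in>carrier M. s \<odot>\<^bsub>M\<^esub> x = n \<oplus>\<^bsub>M\<^esub> a \<odot>\<^bsub>M\<^esub> y" if "x \<in> ?A" for x
    using that unfolding sat_def by force
  have aA: "a \<odot>\<^bsub>M\<^esub> x \<in> ?A" if "x \<in> carrier M" for x
    using seq_sub_smult[OF N, of "[a]" a x] sat_superset[OF P Na] that ac by auto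
  have bB: "b \<odot>\<^bsub>M\<^esub> x \<in> ?B" if "x \<in> carrier M" for x
    using seq_sub_smult[OF N, of "[b]" b x] sat_superset[OF P Nb] that b by auto
  \<comment> \<open>The kernel of \<open>b\<close> on the localized quotient, pulled back to
    \<open>M\<close>; the aim is that it is no larger than \<open>?L\<close>.\<close>
  define K where "K = {x \<in> carrier M. b \<odot>\<^bsub>M\<^esub> x \<in> ?L}"
  have K: "submodule K R M"
    unfolding K_def using b submodule_zero[OF L] submoduleE(3-5)[OF L]
    by (intro submoduleI) (auto simp: smult_r_minus smult_r_distr smult_smult_comm[of b])
  have Kc: "K \<subseteq> carrier M" by (auto simp: K_def)
  \<comment> \<open>If \<open>b\<close> kills \<open>x\<close>, then \<open>x\<close> is divisible
    by \<open>a\<close>, as \<open>b\<close> is injective modulo \<open>a\<close>. The cofactor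
    \<open>y\<close> is again killed by \<open>b\<close>, because \<open>a\<close> is
    injective.\<close>
  have div: "\<exists>s\<in>carrier R - P. \<exists>n\<in>?L. \<exists>y\<in>K. s \<odot>\<^bsub>M\<^esub> x = n \<oplus>\<^bsub>M\<^esub> a \<odot>\<^bsub>M\<^esub> y" if x: "x \<in> K" for x
  proof -
    have xc: "x \<in> carrier M" and bx: "b \<odot>\<^bsub>M\<^esub> x \<in> ?L" using x by (auto simp: K_def)
    then have "x \<in> ?A" using reg(2) LA by (auto simp: nonzerodivisor_def)
    then obtain s n y where s: "s \<in> carrier R - P" "n \<in> N" "y \<in> carrier M" "s \<odot>\<^bsub>M\<^esub> x = n \<oplus>\<^bsub>M\<^esub> a \<odot>\<^bsub>M\<^esub> y"
      using Aex by blast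
    have nL: "n \<in> ?L" using s NL by blast
    then have nc: "n \<in> carrier M" using Lc by blast
    have "s \<odot>\<^bsub>M\<^esub> (b \<odot>\<^bsub>M\<^esub> x) \<in> ?L" using submoduleE(4)[OF L _ bx] s by simp
    moreover have "s \<odot>\<^bsub>M\<^esub> (b \<odot>\<^bsub>M\<^esub> x) = b \<odot>\<^bsub>M\<^esub> (s \<odot>\<^bsub>M\<^esub> x)"
      using s b xc by (simp add: smult_smult_comm)
    moreover have "b \<odot>\<^bsub>M\<^esub> (s \<odot>\<^bsub>M\<^esub> x) = b \<odot>\<^bsub>M\<^esub> n \<oplus>\<^bsub>M\<^esub> a \<odot>\<^bsub>M\<^esub> (b \<odot>\<^bsub>M\<^esub> y)"
      unfolding s(4) using s nc b ac by (simp add: smult_r_distr smult_smult_comm[of b a])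
    ultimately have "b \<odot>\<^bsub>M\<^esub> n \<oplus>\<^bsub>M\<^esub> a \<odot>\<^bsub>M\<^esub> (b \<odot>\<^bsub>M\<^esub> y) \<in> ?L" by (simp only:)
    then have "a \<odot>\<^bsub>M\<^esub> (b \<odot>\<^bsub>M\<^esub> y) \<in> ?L"
      using submodule_add_cancel[OF L] submoduleE(4)[OF L b nL] ac b s by simp
    then have "y \<in> K" using reg(1) s b by (simp add: nonzerodivisor_def K_def)
    then show ?thesis using s nL by blast
  qed
  obtain Y where Y: "finite Y" "Y \<subseteq> K" "gen K = gen Y"
    using finite_generating_subset[OF R fg Kc] by blast
  have Yc: "Y \<subseteq> carrier M" using Y(2) Kc by (rule subset_trans)
  have KY: "K \<subseteq> gen Y" using gen_superset[of K] Y(3) by simp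
  have "Y \<subseteq> sat P (gen (?L \<union> ideal_multiples P Y))"
  proof
    fix x assume "x \<in> Y"
    then have xK: "x \<in> K" using Y(2) by (rule subsetD[rotated])
    then obtain s n y where s: "s \<in> carrier R - P" "n \<in> ?L" "y \<in> K" "s \<odot>\<^bsub>M\<^esub> x = n \<oplus>\<^bsub>M\<^esub> a \<odot>\<^bsub>M\<^esub> y"
      using div by blast
    let ?G = "gen (?L \<union> ideal_multiples P Y)"
    have G: "submodule ?G R M"
      using Lc ideal_multiples_closed[OF P.a_subset Yc] by (intro gen_submodule_submodule) simp
    have "a \<odot>\<^bsub>M\<^esub> y \<in> ?G"
      using smult_mem_gen_multiples[OF P.is_ideal Yc Lc a] KY s(3) by (auto dest: subsetD)
    moreover have "n \<in> ?G" using s(2) gen_superset[of "?L \<union> ideal_multiples P Y"] by auto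
    ultimately have "s \<odot>\<^bsub>M\<^esub> x \<in> ?G" unfolding s(4) using submoduleE(5)[OF G] by simp
    then show "x \<in> sat P ?G" using s(1) xK Kc by (auto simp: sat_def)
  qed
  then have "Y \<subseteq> sat P ?L" by (rule nakayama[OF P L Y(1) Yc])
  \<comment> \<open>Nakayama's lemma was applied over \<open>?L\<close>, which is already saturated,
    so the second saturation is absorbed.\<close>
  then have "gen Y \<subseteq> ?L" unfolding sat_sat[OF P N] by (rule gen_least[OF L])
  then have "K \<subseteq> ?L" using KY by simp
  then have 1: "nonzerodivisor P N b" by (auto simp: nonzerodivisor_def K_def)
  \<comment> \<open>No Nakayama here: if a x = b y, then \<open>y\<close> is divisible by
    \<open>a\<close>, say y = a z, and cancelling \<open>a\<close> gives x = b z, all up to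
    \<open>N\<close> and denominators.\<close>
  have "x \<in> ?B" if x: "x \<in> carrier M" and axB: "a \<odot>\<^bsub>M\<^esub> x \<in> ?B" for x
  proof -
    obtain s n y where s: "s \<in> carrier R - P" "n \<in> N" "y \<in> carrier M"
      "s \<odot>\<^bsub>M\<^esub> (a \<odot>\<^bsub>M\<^esub> x) = n \<oplus>\<^bsub>M\<^esub> b \<odot>\<^bsub>M\<^esub> y"
      using axB unfolding sat_def by force
    have nc: "n \<in> carrier M" using s(2) NL Lc by blast
    have "n \<oplus>\<^bsub>M\<^esub> b \<odot>\<^bsub>M\<^esub> y \<in> ?A" unfolding s(4)[symmetric] using submoduleE(4)[OF A _ aA[OF x]] s(1) by simp
    then have "b \<odot>\<^bsub>M\<^esub> y \<in> ?A"
      using submodule_add_cancel[OF A] s(2,3) NL LA b by (meson smult_closed subsetD)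
    then have "y \<in> ?A" using reg(2) s(3) by (simp add: nonzerodivisor_def)
    then obtain t m z where t: "t \<in> carrier R - P" "m \<in> N" "z \<in> carrier M" "t \<odot>\<^bsub>M\<^esub> y = m \<oplus>\<^bsub>M\<^esub> a \<odot>\<^bsub>M\<^esub> z"
      using Aex by blast
    have mc: "m \<in> carrier M" using t(2) NL Lc by blast
    have sc: "s \<in> carrier R" "t \<in> carrier R" using s t by auto
    \<comment> \<open>The difference x - b z with the denominators \<open>s\<close> and
      \<open>t\<close> cleared.\<close>
    let ?d = "t \<odot>\<^bsub>M\<^esub> (s \<odot>\<^bsub>M\<^esub> x) \<ominus>\<^bsub>M\<^esub> b \<odot>\<^bsub>M\<^esub> z"
    have "a \<odot>\<^bsub>M\<^esub> (t \<odot>\<^bsub>M\<^esub> (s \<odot>\<^bsub>M\<^esub> x)) = t \<odot>\<^bsub>M\<^esub> (s \<odot>\<^bsub>M\<^esub> (a \<odot>\<^bsub>M\<^esub> x))"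
      using x ac sc by (simp add: smult_smult_comm[of a])
    also have "\<dots> = t \<odot>\<^bsub>M\<^esub> n \<oplus>\<^bsub>M\<^esub> b \<odot>\<^bsub>M\<^esub> (t \<odot>\<^bsub>M\<^esub> y)"
      unfolding s(4) using sc b nc s(3) by (simp add: smult_r_distr smult_smult_comm[of b])
    also have "\<dots> = (t \<odot>\<^bsub>M\<^esub> n \<oplus>\<^bsub>M\<^esub> b \<odot>\<^bsub>M\<^esub> m) \<oplus>\<^bsub>M\<^esub> a \<odot>\<^bsub>M\<^esub> (b \<odot>\<^bsub>M\<^esub> z)"
      unfolding t(4) using sc b nc mc t(3) ac
      by (simp add: smult_r_distr smult_smult_comm[of b a] M.a_assoc)
    finally have eq: "a \<odot>\<^bsub>M\<^esub> (t \<odot>\<^bsub>M\<^esub> (s \<odot>\<^bsub>M\<^esub> x)) =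
      (t \<odot>\<^bsub>M\<^esub> n \<oplus>\<^bsub>M\<^esub> b \<odot>\<^bsub>M\<^esub> m) \<oplus>\<^bsub>M\<^esub> a \<odot>\<^bsub>M\<^esub> (b \<odot>\<^bsub>M\<^esub> z)" .
    have "a \<odot>\<^bsub>M\<^esub> ?d = a \<odot>\<^bsub>M\<^esub> (t \<odot>\<^bsub>M\<^esub> (s \<odot>\<^bsub>M\<^esub> x)) \<ominus>\<^bsub>M\<^esub> a \<odot>\<^bsub>M\<^esub> (b \<odot>\<^bsub>M\<^esub> z)"
      using ac b sc x t(3) by (simp add: a_minus_def smult_r_distr smult_r_minus)
    also have "\<dots> = t \<odot>\<^bsub>M\<^esub> n \<oplus>\<^bsub>M\<^esub> b \<odot>\<^bsub>M\<^esub> m"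
      unfolding eq using ac b sc nc mc t(3) by (simp add: a_minus_def M.a_assoc M.r_neg)
    also have "\<dots> \<in> ?L"
      using s(2) t(2) NL sc b by (intro submoduleE(4,5)[OF L]) auto
    finally have "?d \<in> ?L" using reg(1) sc b x t(3) by (simp add: nonzerodivisor_def)
    then have "?d \<oplus>\<^bsub>M\<^esub> b \<odot>\<^bsub>M\<^esub> z \<in> ?B" using LB bB[OF t(3)] submoduleE(5)[OF B] by blast
    moreover have "?d \<oplus>\<^bsub>M\<^esub> b \<odot>\<^bsub>M\<^esub> z = t \<odot>\<^bsub>M\<^esub> (s \<odot>\<^bsub>M\<^esub> x)"
      using sc b x t(3) by (simp add: a_minus_def M.a_assoc M.l_neg)
    ultimately have "t \<odot>\<^bsub>M\<^esub> (s \<odot>\<^bsub>M\<^esub> x) \<in> ?B" by simp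
    then have "s \<odot>\<^bsub>M\<^esub> x \<in> ?B" using sat_cancel[OF P t(1)] sc x by simp
    then show ?thesis using sat_cancel[OF P s(1) x] by simp
  qed
  then show ?thesis using 1 by (simp add: nonzerodivisor_def)
qed

lemma regular_swap:
  assumes "noetherian_ring R" "fin_gen_module R M" and P: "primeideal P R"
    and N: "submodule N R M" and a: "a \<in> P" and b: "b \<in> P"
  shows "regular P N (a # b # fs) \<longleftrightarrow> regular P N (b # a # fs)"
proof -
  have c: "a \<in> carrier R" "b \<in> carrier R"
    using a b ideal.Icarr[OF primeideal.axioms(1)[OF P]] by auto
  have "seq_sub M N [a, b] = seq_sub M N [b, a]" using c by (intro seq_sub_set_eq N) auto
  then have "seq_sub M (seq_sub M N [a]) [b] = seq_sub M (seq_sub M N [b]) [a]" by simp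
  then show ?thesis
    using nonzerodivisor_swap[OF assms(1-4) a c(2)] nonzerodivisor_swap[OF assms(1-4) b c(1)]
    by (simp only: regular.simps) blast
qed

text \<open>The element \<open>y\<close> moves through the list by swaps of neighbours, each one
  modulo the entries before it.\<close>

lemma regular_rotate:
  assumes R: "noetherian_ring R" and fg: "fin_gen_module R M" and P: "primeideal P R"
    and N: "submodule N R M" and fs: "set fs \<subseteq> P" and y: "y \<in> P"
  shows "regular P N (fs @ [y]) \<longleftrightarrow> regular P N (y # fs)"
  using N fs
proof (induction fs arbitrary: N)
  case (Cons a fs)
  have "submodule (seq_sub M N [a]) R M"
    using Cons.prems ideal.Icarr[OF primeideal.axioms(1)[OF P]] by (intro seq_sub_submodule) auto
  then have "regular P N ((a # fs) @ [y]) \<longleftrightarrow> regular P N (a # y # fs)"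
    using Cons.IH Cons.prems by (simp only: append_Cons regular.simps(2)) simp
  also have "\<dots> \<longleftrightarrow> regular P N (y # a # fs)"
    using Cons.prems y by (intro regular_swap[OF R fg P]) auto
  finally show ?case .
qed simp

text \<open>Prime avoidance applies because a maximal annihilator \<open>Q\<close> of \<open>M\<close> modulo \<open>fs'\<close> (that is, \<open>fs\<close> without
  its last entry \<open>f\<close>) cannot contain \<open>g # gs\<close>: as \<open>f \<notin> Q\<close>, otherwise \<open>M\<close> would equal \<open>Q M + N\<close> after
  localization at \<open>Q\<close>, and Nakayama's lemma at \<open>Q\<close> gives a contradiction.\<close>

theorem regular_exchange:
  assumes R: "noetherian_ring R" and fg: "fin_gen_module R M" and P: "primeideal P R"
    and "submodule N R M" "length fs = length gs" "set fs \<subseteq> P" "set gs \<subseteq> P" "regular P N fs"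
    and "\<And>f x. f \<in> set fs \<Longrightarrow> x \<in> carrier M \<Longrightarrow> \<exists>k::nat. (f [^] k) \<odot>\<^bsub>M\<^esub> x \<in> sat P (seq_sub M N gs)"
  shows "regular P N gs"
  using assms(4-)
proof (induction gs arbitrary: fs N)
  case (Cons g gs)
  interpret P: primeideal P R by fact
  note N = Cons.prems(1)
  have gc: "g \<in> carrier R" and gsc: "set gs \<subseteq> carrier R" using Cons.prems(4) P.Icarr by auto
  have ggsc: "set (g # gs) \<subseteq> carrier R" using gc gsc by simp
  obtain fs' f where fs: "fs = fs' @ [f]"
    using Cons.prems(2) by (cases fs rule: rev_exhaust) auto
  have fP: "f \<in> P" "set fs' \<subseteq> P" using Cons.prems(3) fs by auto
  have fc: "f \<in> carrier R" "set fs' \<subseteq> carrier R" using fP P.Icarr by auto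
  have N': "submodule (seq_sub M N fs') R M" using N fc by (intro seq_sub_submodule)
  let ?L = "sat P (seq_sub M N fs')"
  have L: "submodule ?L R M" by (rule sat_submodule[OF P N'])
  have NL: "N \<subseteq> ?L"
    using seq_sub_superset[OF N fc(2)] sat_superset[OF P N'] by (rule subset_trans)
  have reg: "regular P N fs'" "nonzerodivisor P (seq_sub M N fs') f"
    using Cons.prems(5) unfolding fs by (simp_all add: regular_append)
  obtain \<Q> where fin: "finite \<Q>" and prime: "\<And>Q. Q \<in> \<Q> \<Longrightarrow> primeideal Q R"
    and colon: "\<And>Q. Q \<in> \<Q> \<Longrightarrow> \<exists>y\<in>carrier M - ?L. Q = colon ?L y"
    and incomp: "\<And>Q Q'. Q \<in> \<Q> \<Longrightarrow> Q' \<in> \<Q> \<Longrightarrow> Q \<subseteq> Q' \<Longrightarrow> Q = Q'"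
    and cover: "\<And>x. x \<in> carrier M - ?L \<Longrightarrow> \<exists>Q\<in>\<Q>. colon ?L x \<subseteq> Q"
    using that by (rule ex_zero_divisor_primes[OF R fg L])
  let ?J = "Idl (set gs)"
  have J: "ideal ?J R" using gsc by (rule R.genideal_ideal)
  have avoid: "\<not> (g \<in> Q \<and> ?J \<subseteq> Q)" if Q: "Q \<in> \<Q>" for Q
  proof
    assume *: "g \<in> Q \<and> ?J \<subseteq> Q"
    then have gsQ: "set (g # gs) \<subseteq> Q" using R.genideal_self[OF gsc] by auto
    interpret Q: primeideal Q R by (rule prime[OF Q])
    from colon[OF Q] obtain y where y': "y \<in> carrier M - ?L" and yQ: "Q = colon ?L y" by (rule bexE)
    note y = DiffD1[OF y'] DiffD2[OF y']
    have memQ: "a \<in> Q \<longleftrightarrow> a \<in> carrier R \<and> a \<odot>\<^bsub>M\<^esub> y \<in> ?L" for a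
      unfolding yQ colon_def by (rule mem_Collect_eq)
    \<comment> \<open>An element outside \<open>P\<close> cannot annihilate \<open>y\<close> modulo
      \<open>?L\<close>, because \<open>?L\<close> is saturated at \<open>P\<close>.\<close>
    have QP: "Q \<subseteq> P"
    proof
      fix a assume a: "a \<in> Q"
      then have "a \<in> carrier R" "a \<odot>\<^bsub>M\<^esub> y \<in> ?L" unfolding memQ by blast+
      then show "a \<in> P" using sat_cancel[OF P, of a y] y(1,2) by blast
    qed
    \<comment> \<open>The nonzerodivisor \<open>f\<close> cannot annihilate the nonzero class of
      \<open>y\<close>.\<close>
    have "f \<notin> Q" using reg(2) y unfolding memQ nonzerodivisor_def by blast
    then have "f \<in> carrier R - Q" using fc by blast
    then have fk: "f [^] k \<in> carrier R - Q" for k :: nat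
      by (induction k)
        (simp_all only: R.nat_pow_0 R.nat_pow_Suc prime_compl_one[OF Q.primeideal]
          prime_compl_mult[OF Q.primeideal])
    obtain X where X: "finite X" "X \<subseteq> carrier M" "gen X = carrier M"
      using fg by (auto simp: fin_gen_module_def)
    let ?T = "gen (N \<union> ideal_multiples Q X)"
    have Nc: "N \<subseteq> carrier M" by (rule submoduleE(1)[OF N])
    have T: "submodule ?T R M"
      using Nc ideal_multiples_closed[OF Q.a_subset X(2)] by (intro gen_submodule_submodule) simp
    have "h \<odot>\<^bsub>M\<^esub> x \<in> ?T" if "h \<in> set (g # gs)" "x \<in> carrier M" for h x
      using smult_mem_gen_multiples[OF Q.is_ideal X(2) Nc subsetD[OF gsQ that(1)]] X(3) that(2) by blast
    then have sub: "seq_sub M N (g # gs) \<subseteq> ?T"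
      using gen_superset[of "N \<union> ideal_multiples Q X"] by (intro seq_sub_least T) auto
    have "X \<subseteq> sat Q ?T"
    proof
      fix x assume x: "x \<in> X"
      then have xc: "x \<in> carrier M" using X(2) by blast
      obtain k :: nat where "(f [^] k) \<odot>\<^bsub>M\<^esub> x \<in> sat P (seq_sub M N (g # gs))"
        using Cons.prems(6)[of f x] xc fs by auto
      \<comment> \<open>The prime \<open>Q\<close> contains \<open>g # gs\<close>, so the submodule
        in the hypothesis lies in N + QM; shrinking the prime from \<open>P\<close> to
        \<open>Q\<close> then makes the powers of \<open>f\<close> invertible.\<close>
      then have "(f [^] k) \<odot>\<^bsub>M\<^esub> x \<in> sat Q ?T" using sat_mono[OF sub] sat_antimono[OF QP] by blast
      then show "x \<in> sat Q ?T" by (rule sat_cancel[OF Q.primeideal fk xc])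
    qed
    then have "X \<subseteq> sat Q N" by (rule nakayama[OF Q.primeideal N X(1,2)])
    then have "carrier M \<subseteq> sat Q N"
      unfolding X(3)[symmetric] by (rule gen_least[OF sat_submodule[OF Q.primeideal N]])
    then have "y \<in> sat Q N" using y(1) by blast
    then obtain t where t: "t \<in> carrier R - Q" "t \<odot>\<^bsub>M\<^esub> y \<in> N" by (auto simp: sat_def)
    then show False using NL memQ[of t] by blast
  qed
  \<comment> \<open>The correction \<open>j\<close> comes from the ideal of the remaining entries
    \<open>gs\<close>, hence acts as zero modulo them.\<close>
  obtain j where j: "j \<in> ?J" "\<And>Q. Q \<in> \<Q> \<Longrightarrow> g \<oplus> j \<notin> Q"
    using R.coset_prime_avoidance[OF gc J fin prime incomp avoid] by blast
  have jc: "j \<in> carrier R" by (rule ideal.Icarr[OF J j(1)])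
  define y where "y = g \<oplus> j"
  have yc: "y \<in> carrier R" using gc jc by (simp add: y_def)
  have jP: "j \<in> P" using j(1) R.genideal_minimal[OF P.is_ideal, of "set gs"] Cons.prems(4) by auto
  have yP: "y \<in> P" unfolding y_def using Cons.prems(4) jP by (intro P.a_closed) auto
  have jmem: "j \<odot>\<^bsub>M\<^esub> x \<in> K"
    if "submodule K R M" "x \<in> carrier M" "\<And>h x. h \<in> set gs \<Longrightarrow> x \<in> carrier M \<Longrightarrow> h \<odot>\<^bsub>M\<^esub> x \<in> K" for K x
    using Idl_smult_mem[OF that(1) gsc that(3) j(1) that(2)] .
  have "nonzerodivisor P (seq_sub M N fs') y"
    unfolding nonzerodivisor_def
  proof (intro ballI impI, rule ccontr)
    fix x assume x: "x \<in> carrier M" "y \<odot>\<^bsub>M\<^esub> x \<in> ?L" "x \<notin> ?L"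
    then obtain Q where "Q \<in> \<Q>" "colon ?L x \<subseteq> Q" using cover by blast
    moreover have "y \<in> colon ?L x" using x yc by (simp add: colon_def)
    ultimately show False using j(2) unfolding y_def by blast
  qed
  then have "regular P N (fs' @ [y])" using reg(1) by (simp add: regular_append)
  then have "regular P N (y # fs')" using regular_rotate[OF R fg P N fP(2) yP] by simp
  then have y1: "nonzerodivisor P N y" and regy: "regular P (seq_sub M N [y]) fs'" by simp_all
  have Ny: "submodule (seq_sub M N [y]) R M" using yc by (intro seq_sub_submodule N) simp
  have ygsc: "set (y # gs) \<subseteq> carrier R" using yc gsc by simp
  have Nygs: "submodule (seq_sub M N (y # gs)) R M" by (rule seq_sub_submodule[OF N ygsc])
  \<comment> \<open>Since g = y - j, the entry \<open>g\<close> is recovered from \<open>y\<close>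
    and \<open>gs\<close>, and the hypothesis on powers passes to \<open>y # gs\<close>.\<close>
  have "h \<odot>\<^bsub>M\<^esub> x \<in> seq_sub M N (y # gs)" if h: "h \<in> set (g # gs)" and x: "x \<in> carrier M" for h x
  proof (cases "h \<in> set gs")
    case True
    then show ?thesis using x by (intro seq_sub_smult N ygsc) simp_all
  next
    case False
    then have "h = g" using h by simp
    have "j \<odot>\<^bsub>M\<^esub> x \<in> seq_sub M N (y # gs)"
      by (rule jmem[OF Nygs x]) (intro seq_sub_smult N ygsc, simp_all)
    moreover have "y \<odot>\<^bsub>M\<^esub> x \<in> seq_sub M N (y # gs)" using x by (intro seq_sub_smult N ygsc) simp_all
    moreover have "y \<odot>\<^bsub>M\<^esub> x = j \<odot>\<^bsub>M\<^esub> x \<oplus>\<^bsub>M\<^esub> g \<odot>\<^bsub>M\<^esub> x"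
      using x gc jc by (simp add: y_def smult_l_distr M.a_comm)
    ultimately show ?thesis
      using submodule_add_cancel[OF Nygs, of "j \<odot>\<^bsub>M\<^esub> x" "g \<odot>\<^bsub>M\<^esub> x"] x gc \<open>h = g\<close>
      by (simp only: smult_closed)
  qed
  then have "seq_sub M N (g # gs) \<subseteq> seq_sub M N (y # gs)"
    by (intro seq_sub_least Nygs seq_sub_superset N ygsc)
  moreover have "seq_sub M N (y # gs) = seq_sub M (seq_sub M N [y]) gs" by simp
  ultimately have sub: "sat P (seq_sub M N (g # gs)) \<subseteq> sat P (seq_sub M (seq_sub M N [y]) gs)"
    by (intro sat_mono) (simp only:)
  \<comment> \<open>The induction hypothesis is used modulo \<open>y\<close>, with
    \<open>fs'\<close> as the regular sequence: \<open>f\<close> has been traded for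
    \<open>y\<close>.\<close>
  have "regular P (seq_sub M N [y]) gs"
  proof (rule Cons.IH[OF Ny _ fP(2) _ regy])
    show "length fs' = length gs" using Cons.prems(2) fs by simp
    show "set gs \<subseteq> P" using Cons.prems(4) by simp
    fix h x assume "h \<in> set fs'" "x \<in> carrier M"
    then have "\<exists>k::nat. (h [^] k) \<odot>\<^bsub>M\<^esub> x \<in> sat P (seq_sub M N (g # gs))"
      using fs by (intro Cons.prems(6)) simp_all
    then show "\<exists>k::nat. (h [^] k) \<odot>\<^bsub>M\<^esub> x \<in> sat P (seq_sub M (seq_sub M N [y]) gs)"
      using sub by blast
  qed
  then have "regular P N (y # gs)" using y1 by simp
  then have "regular P N (gs @ [y])"
    using regular_rotate[OF R fg P N _ yP, of gs] Cons.prems(4) by simp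
  then have gs: "regular P N gs" "nonzerodivisor P (seq_sub M N gs) y"
    by (simp_all add: regular_append)
  have Ngs: "submodule (seq_sub M N gs) R M" using gsc by (rule seq_sub_submodule[OF N])
  \<comment> \<open>Modulo \<open>gs\<close> the elements \<open>g\<close> and \<open>y\<close> act
    in the same way.\<close>
  have "nonzerodivisor P (seq_sub M N gs) g"
    unfolding nonzerodivisor_def
  proof (intro ballI impI)
    fix x assume x: "x \<in> carrier M" "g \<odot>\<^bsub>M\<^esub> x \<in> sat P (seq_sub M N gs)"
    have "j \<odot>\<^bsub>M\<^esub> x \<in> seq_sub M N gs"
      by (rule jmem[OF Ngs x(1)]) (rule seq_sub_smult[OF N gsc])
    then have "j \<odot>\<^bsub>M\<^esub> x \<in> sat P (seq_sub M N gs)" using sat_superset[OF P Ngs] by blast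
    then have "y \<odot>\<^bsub>M\<^esub> x \<in> sat P (seq_sub M N gs)"
      using x gc jc submoduleE(5)[OF sat_submodule[OF P Ngs]] by (simp add: y_def smult_l_distr)
    then show "x \<in> sat P (seq_sub M N gs)" using gs(2) x(1) by (simp add: nonzerodivisor_def)
  qed
  then have "regular P N (gs @ [g])" using gs(1) by (simp add: regular_append)
  then show ?case using regular_rotate[OF R fg P N, of gs g] Cons.prems(4) by simp
qed simp

end

section \<open>Elementwise form of support and regularity\<close>

context module
begin

lemma zero_submodule: "submodule {\<zero>\<^bsub>M\<^esub>} R M"
  by (rule submoduleI) auto

lemma ideal_smult_eq_seq_sub:
  assumes fs: "set fs \<subseteq> carrier R"
  shows "ideal_smult R (Idl (set fs)) M = seq_sub M {\<zero>\<^bsub>M\<^esub>} fs"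
proof (rule subset_antisym)
  note S = seq_sub_submodule[OF zero_submodule fs]
  have I: "ideal (Idl (set fs)) R" by (rule R.genideal_ideal[OF fs])
  show "ideal_smult R (Idl (set fs)) M \<subseteq> seq_sub M {\<zero>\<^bsub>M\<^esub>} fs"
    unfolding ideal_smult_def
    using Idl_smult_mem[OF S fs seq_sub_smult[OF zero_submodule fs]]
    by (intro gen_least S) auto
  have K: "submodule (ideal_smult R (Idl (set fs)) M) R M"
    by (intro ideal_smult_submodule subsetI ideal.Icarr[OF I])
  show "seq_sub M {\<zero>\<^bsub>M\<^esub>} fs \<subseteq> ideal_smult R (Idl (set fs)) M"
  proof (rule seq_sub_least[OF K])
    show "{\<zero>\<^bsub>M\<^esub>} \<subseteq> ideal_smult R (Idl (set fs)) M" using submodule_zero[OF K] by simp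
    fix f x assume "f \<in> set fs" "x \<in> carrier M"
    then have "f \<odot>\<^bsub>M\<^esub> x \<in> {a \<odot>\<^bsub>M\<^esub> x | a x. a \<in> Idl (set fs) \<and> x \<in> carrier M}"
      using R.genideal_self[OF fs] by blast
    then show "f \<odot>\<^bsub>M\<^esub> x \<in> ideal_smult R (Idl (set fs)) M"
      unfolding ideal_smult_def by (rule subsetD[OF gen_superset])
  qed
qed

lemma quot_by_seq_eq:
  "set fs \<subseteq> carrier R \<Longrightarrow> quot_by_seq R M fs = quot_module M (seq_sub M {\<zero>\<^bsub>M\<^esub>} fs)"
  by (simp add: quot_by_seq_def ideal_smult_eq_seq_sub)

lemma coset_eq_iff:
  assumes N: "submodule N R M" and x: "x \<in> carrier M" and y: "y \<in> carrier M"
  shows "N +>\<^bsub>M\<^esub> x = N +>\<^bsub>M\<^esub> y \<longleftrightarrow> x \<ominus>\<^bsub>M\<^esub> y \<in> N"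
proof
  have sub: "subgroup N (add_monoid M)" by (rule submodule.axioms(1)[OF N])
  {
    assume "N +>\<^bsub>M\<^esub> x = N +>\<^bsub>M\<^esub> y"
    then have "x \<in> N +>\<^bsub>M\<^esub> y" using M.add.rcos_self[OF x sub, folded a_r_coset_def] by simp
    then obtain h where h: "h \<in> N" "x = h \<oplus>\<^bsub>M\<^esub> y" unfolding a_r_coset_def' by blast
    have "h \<in> carrier M" using h(1) submoduleE(1)[OF N] by blast
    then show "x \<ominus>\<^bsub>M\<^esub> y \<in> N" using h y by (simp add: a_minus_def M.a_assoc M.r_neg)
  next
    assume "x \<ominus>\<^bsub>M\<^esub> y \<in> N"
    moreover have "x = (x \<ominus>\<^bsub>M\<^esub> y) \<oplus>\<^bsub>M\<^esub> y" using x y by (simp add: a_minus_def M.a_assoc M.l_neg)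
    ultimately have "x \<in> N +>\<^bsub>M\<^esub> y" unfolding a_r_coset_def' by blast
    then show "N +>\<^bsub>M\<^esub> x = N +>\<^bsub>M\<^esub> y"
      using M.add.repr_independence[OF _ y sub, folded a_r_coset_def] by metis
  }
qed

lemma diff_zero: "x \<in> carrier M \<Longrightarrow> x \<ominus>\<^bsub>M\<^esub> \<zero>\<^bsub>M\<^esub> = x"
  using M.add.inv_one by (simp add: a_minus_def a_inv_def)

lemma quot_module_carrier: "carrier (quot_module M N) = (\<lambda>x. N +>\<^bsub>M\<^esub> x) ` carrier M"
  by (auto simp: quot_module_def A_RCOSETS_def')

lemma coset_eq_zero_iff:
  assumes N: "submodule N R M" and x: "x \<in> carrier M"
  shows "N +>\<^bsub>M\<^esub> x = \<zero>\<^bsub>quot_module M N\<^esub> \<longleftrightarrow> x \<in> N"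
proof -
  have "\<zero>\<^bsub>quot_module M N\<^esub> = N +>\<^bsub>M\<^esub> \<zero>\<^bsub>M\<^esub>"
    using M.a_coset_add_zero[OF submoduleE(1)[OF N]] by (simp add: quot_module_def)
  then show ?thesis using coset_eq_iff[OF N x M.zero_closed] x by (simp add: diff_zero)
qed

lemma inj_on_smult_quot_module:
  assumes N: "submodule N R M" and f: "f \<in> carrier R"
  shows "inj_on (\<lambda>X. f \<odot>\<^bsub>quot_module M N\<^esub> X) (carrier (quot_module M N)) \<longleftrightarrow>
    (\<forall>x\<in>carrier M. f \<odot>\<^bsub>M\<^esub> x \<in> N \<longrightarrow> x \<in> N)"
proof -
  have diff: "f \<odot>\<^bsub>M\<^esub> x \<ominus>\<^bsub>M\<^esub> f \<odot>\<^bsub>M\<^esub> y = f \<odot>\<^bsub>M\<^esub> (x \<ominus>\<^bsub>M\<^esub> y)"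
    if "x \<in> carrier M" "y \<in> carrier M" for x y
    using that f by (simp add: a_minus_def smult_r_distr smult_r_minus)
  have "inj_on (\<lambda>X. f \<odot>\<^bsub>quot_module M N\<^esub> X) (carrier (quot_module M N)) \<longleftrightarrow>
    (\<forall>x\<in>carrier M. \<forall>y\<in>carrier M. f \<odot>\<^bsub>M\<^esub> (x \<ominus>\<^bsub>M\<^esub> y) \<in> N \<longrightarrow> x \<ominus>\<^bsub>M\<^esub> y \<in> N)"
    using f by (simp add: inj_on_def quot_module_carrier quot_module_smult[OF N f] coset_eq_iff[OF N] diff)
  also have "\<dots> \<longleftrightarrow> (\<forall>x\<in>carrier M. f \<odot>\<^bsub>M\<^esub> x \<in> N \<longrightarrow> x \<in> N)"
  proof
    assume *: "\<forall>x\<in>carrier M. \<forall>y\<in>carrier M. f \<odot>\<^bsub>M\<^esub> (x \<ominus>\<^bsub>M\<^esub> y) \<in> N \<longrightarrow> x \<ominus>\<^bsub>M\<^esub> y \<in> N"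
    show "\<forall>x\<in>carrier M. f \<odot>\<^bsub>M\<^esub> x \<in> N \<longrightarrow> x \<in> N"
    proof
      fix x assume "x \<in> carrier M"
      then show "f \<odot>\<^bsub>M\<^esub> x \<in> N \<longrightarrow> x \<in> N"
        using *[THEN bspec, THEN bspec, OF _ M.zero_closed, of x] by (simp add: diff_zero)
    qed
  qed simp
  finally show ?thesis .
qed

lemma strongly_regular_seq_iff:
  assumes fs: "set fs \<subseteq> carrier R"
  shows "strongly_regular_seq R M fs \<longleftrightarrow>
    (\<forall>i<length fs. \<forall>x\<in>carrier M. fs ! i \<odot>\<^bsub>M\<^esub> x \<in> seq_sub M {\<zero>\<^bsub>M\<^esub>} (take i fs) \<longrightarrow>
      x \<in> seq_sub M {\<zero>\<^bsub>M\<^esub>} (take i fs))"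
proof -
  have t: "set (take i fs) \<subseteq> carrier R" for i using fs set_take_subset[of i fs] by blast
  have n: "fs ! i \<in> carrier R" if "i < length fs" for i using fs that by auto
  show ?thesis
    unfolding strongly_regular_seq_def quot_by_seq_eq[OF t]
    by (intro all_cong1 imp_cong refl inj_on_smult_quot_module[OF seq_sub_submodule[OF zero_submodule t] n])
qed

text \<open>A fraction vanishes exactly when some element outside \<open>P\<close> carries its
  numerator into \<open>N\<close>, whatever the denominator.\<close>

lemma Supp_quot_module:
  assumes N: "submodule N R M"
  shows "P \<in> Supp R (quot_module M N) \<longleftrightarrow> primeideal P R \<and> \<not> carrier M \<subseteq> sat P N"
proof (cases "primeideal P R")
  case P: True
  let ?S = "carrier R - P" and ?Q = "quot_module M N"
  interpret Q: localization R ?Q ?S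
    using quot_module_module[OF N] primeideal_submonoid[OF P] by (simp add: localization_def)
  have eq: "frac_cl ?Q ?S (N +>\<^bsub>M\<^esub> x) s = \<zero>\<^bsub>loc_module R ?S ?Q\<^esub> \<longleftrightarrow> x \<in> sat P N"
    if x: "x \<in> carrier M" and s: "s \<in> ?S" for x s
  proof -
    have X: "N +>\<^bsub>M\<^esub> x \<in> carrier ?Q" using x by (simp add: quot_module_carrier)
    have "frac_cl ?Q ?S (N +>\<^bsub>M\<^esub> x) s = \<zero>\<^bsub>loc_module R ?S ?Q\<^esub> \<longleftrightarrow>
      (\<exists>u\<in>?S. u \<odot>\<^bsub>?Q\<^esub> (N +>\<^bsub>M\<^esub> x) = \<zero>\<^bsub>?Q\<^esub>)"
      unfolding Q.loc_module_zero
      using s X Q.one_closed by (subst Q.frac_cl_eq_iff) auto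
    also have "\<dots> \<longleftrightarrow> (\<exists>u\<in>?S. u \<odot>\<^bsub>M\<^esub> x \<in> N)"
      using x by (auto simp: quot_module_smult[OF N] coset_eq_zero_iff[OF N])
    finally show ?thesis using x by (simp add: sat_def)
  qed
  have "carrier (loc_module R ?S ?Q) \<noteq> {\<zero>\<^bsub>loc_module R ?S ?Q\<^esub>} \<longleftrightarrow>
    (\<exists>X\<in>carrier (loc_module R ?S ?Q). X \<noteq> \<zero>\<^bsub>loc_module R ?S ?Q\<^esub>)"
    using abelian_group.axioms(1)[OF Q.loc_module_abelian_group, THEN abelian_monoid.zero_closed] by blast
  also have "\<dots> \<longleftrightarrow> (\<exists>x\<in>carrier M. \<exists>s\<in>?S. frac_cl ?Q ?S (N +>\<^bsub>M\<^esub> x) s \<noteq> \<zero>\<^bsub>loc_module R ?S ?Q\<^esub>)"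
    unfolding Q.loc_module_carrier quot_module_carrier by blast
  also have "\<dots> \<longleftrightarrow> \<not> carrier M \<subseteq> sat P N"
    using eq Q.one_closed by blast
  finally show ?thesis using P by (simp add: Supp_def module_at_def)
qed (simp add: Supp_def)

lemma mem_Supp_quot_by_seq_iff:
  assumes "set fs \<subseteq> carrier R"
  shows "P \<in> Supp R (quot_by_seq R M fs) \<longleftrightarrow>
    primeideal P R \<and> \<not> carrier M \<subseteq> sat P (seq_sub M {\<zero>\<^bsub>M\<^esub>} fs)"
  using assms by (simp add: quot_by_seq_eq Supp_quot_module seq_sub_submodule[OF zero_submodule])

text \<open>An entry outside \<open>P\<close> would act both as zero and invertibly on the localized
  quotient, which would then vanish.\<close>

lemma Supp_quot_by_seq_subset:
  assumes fs: "set fs \<subseteq> carrier R" and P: "P \<in> Supp R (quot_by_seq R M fs)"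
  shows "set fs \<subseteq> P"
proof
  fix f assume f: "f \<in> set fs"
  have p: "primeideal P R" "\<not> carrier M \<subseteq> sat P (seq_sub M {\<zero>\<^bsub>M\<^esub>} fs)"
    using P mem_Supp_quot_by_seq_iff[OF fs] by auto
  then show "f \<in> P"
    using seq_sub_smult[OF zero_submodule fs f] f fs by (auto simp: sat_def)
qed

text \<open>If no power of \<open>f\<close> carries \<open>x\<close> into the submodule of
  \<open>gs\<close>, an annihilator maximal among those of elements with this property is prime. It
  lies in the support of the quotient by \<open>gs\<close>, hence in that by \<open>fs\<close>, and
  so contains \<open>f\<close>, against its choice.\<close>

lemma Supp_subset_imp_power_mem:
  assumes R: "noetherian_ring R" and fs: "set fs \<subseteq> carrier R" and gs: "set gs \<subseteq> carrier R"
    and Supp: "Supp R (quot_by_seq R M gs) \<subseteq> Supp R (quot_by_seq R M fs)"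
    and f: "f \<in> set fs" and x: "x \<in> carrier M"
  shows "\<exists>k::nat. (f [^] k) \<odot>\<^bsub>M\<^esub> x \<in> seq_sub M {\<zero>\<^bsub>M\<^esub>} gs"
proof (rule ccontr)
  let ?G = "seq_sub M {\<zero>\<^bsub>M\<^esub>} gs"
  assume neg: "\<not> ?thesis"
  have fc: "f \<in> carrier R" using f fs by blast
  have G: "submodule ?G R M" by (rule seq_sub_submodule[OF zero_submodule gs])
  let ?S = "range (\<lambda>k::nat. f [^] k)"
  have S: "submonoid ?S R"
  proof
    show "?S \<subseteq> carrier R" using fc by auto
    show "a \<otimes> b \<in> ?S" if "a \<in> ?S" "b \<in> ?S" for a b
      using that fc by (auto simp: R.nat_pow_mult)
    show "\<one> \<in> ?S" using R.nat_pow_0[of f] by (metis rangeI)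
  qed
  have x': "\<forall>s\<in>?S. s \<odot>\<^bsub>M\<^esub> x \<notin> ?G" using neg by blast
  obtain y where y: "y \<in> carrier M" "\<forall>s\<in>?S. s \<odot>\<^bsub>M\<^esub> y \<notin> ?G" "colon ?G x \<subseteq> colon ?G y"
    and max: "\<forall>z\<in>carrier M. (\<forall>s\<in>?S. s \<odot>\<^bsub>M\<^esub> z \<notin> ?G) \<longrightarrow> colon ?G y \<subseteq> colon ?G z
      \<longrightarrow> colon ?G z = colon ?G y"
    using that by (rule ex_maximal_colon[OF R G x x'])
  have "primeideal (colon ?G y) R" by (rule maximal_colon_prime[OF S G y(1,2) max])
  \<comment> \<open>Anything that carries \<open>y\<close> into \<open>?G\<close> belongs to the
    prime by definition, so the class of \<open>y\<close> survives localization there.\<close>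
  moreover have "y \<notin> sat (colon ?G y) ?G" by (auto simp: sat_def colon_def)
  ultimately have "colon ?G y \<in> Supp R (quot_by_seq R M gs)"
    using y(1) mem_Supp_quot_by_seq_iff[OF gs] by blast
  then have "f \<in> colon ?G y" using Supp Supp_quot_by_seq_subset[OF fs] f by blast
  moreover have "f \<in> ?S" using R.nat_pow_eone[OF fc] by (metis rangeI)
  ultimately show False using y(2) by (auto simp: colon_def)
qed

end

section \<open>Localized submodules inside a localized module\<close>

context localization
begin

definition loc_sub :: "'c set \<Rightarrow> ('c \<times> 'a) set set" where
  "loc_sub N = {frac_cl M S x s | x s. x \<in> N \<and> s \<in> S}"

text \<open>A fraction may lie in \<open>loc_sub N\<close> although its displayed numerator is not
  in \<open>N\<close>; expanding it by \<open>u\<close> exhibits a numerator that is.\<close>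

lemma frac_cl_mem_loc_sub_iff:
  assumes N: "submodule N R M" and x: "x \<in> carrier M" and s: "s \<in> S"
  shows "frac_cl M S x s \<in> loc_sub N \<longleftrightarrow> (\<exists>u\<in>S. u \<odot>\<^bsub>M\<^esub> x \<in> N)"
proof
  assume "frac_cl M S x s \<in> loc_sub N"
  then obtain y t where y: "y \<in> N" "t \<in> S" "frac_cl M S x s = frac_cl M S y t"
    by (auto simp: loc_sub_def)
  have yc: "y \<in> carrier M" using y(1) submoduleE(1)[OF N] by blast
  obtain u where u: "u \<in> S" "u \<odot>\<^bsub>M\<^esub> (t \<odot>\<^bsub>M\<^esub> x) = u \<odot>\<^bsub>M\<^esub> (s \<odot>\<^bsub>M\<^esub> y)"
    using y(3) frac_cl_eq_iff[OF x s yc y(2)] by blast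
  have "(u \<otimes> t) \<odot>\<^bsub>M\<^esub> x = u \<odot>\<^bsub>M\<^esub> (s \<odot>\<^bsub>M\<^esub> y)" using u y x by (simp add: smult_assoc1 S_carrier)
  also have "\<dots> \<in> N" using u(1) s y(1) by (intro submoduleE(4)[OF N] S_carrier)
  finally show "\<exists>u\<in>S. u \<odot>\<^bsub>M\<^esub> x \<in> N" using m_closed[OF u(1) y(2)] by blast
next
  assume "\<exists>u\<in>S. u \<odot>\<^bsub>M\<^esub> x \<in> N"
  then obtain u where u: "u \<in> S" "u \<odot>\<^bsub>M\<^esub> x \<in> N" by blast
  have "frac_cl M S x s = frac_cl M S (u \<odot>\<^bsub>M\<^esub> x) (u \<otimes> s)"
    using u(1) s x by (intro frac_cl_eqI) (auto simp: S_carrier smult_assoc1 smult_smult_comm[of u])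
  then show "frac_cl M S x s \<in> loc_sub N" using u m_closed[OF u(1) s] by (auto simp: loc_sub_def)
qed

text \<open>Localization commutes with N + fM: one inclusion brings two fractions to a common
  denominator, the other splits a numerator over the denominator it has.\<close>

lemma seq_sub_loc_module:
  assumes "submodule N R M" "set fs \<subseteq> carrier R"
  shows "seq_sub (loc_module R S M) (loc_sub N) (map (\<lambda>f. frac_cl (regular_module R) S f \<one>) fs) =
    loc_sub (seq_sub M N fs)"
  using assms
proof (induction fs arbitrary: N)
  case (Cons f fs)
  note N = Cons.prems(1)
  have f: "f \<in> carrier R" using Cons.prems by simp
  let ?T = "{n \<oplus>\<^bsub>M\<^esub> f \<odot>\<^bsub>M\<^esub> x | n x. n \<in> N \<and> x \<in> carrier M}"
  let ?U = "{Z \<oplus>\<^bsub>loc_module R S M\<^esub> frac_cl (regular_module R) S f \<one> \<odot>\<^bsub>loc_module R S M\<^esub> X | Z X.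
    Z \<in> loc_sub N \<and> X \<in> carrier (loc_module R S M)}"
  note c = subsetD[OF submoduleE(1)[OF N]] f S_carrier
  have "?U = loc_sub ?T"
  proof (rule subset_antisym; rule subsetI)
    fix Y assume "Y \<in> ?U"
    then obtain n s x t where *: "n \<in> N" "s \<in> S" "x \<in> carrier M" "t \<in> S"
      "Y = frac_cl M S n s \<oplus>\<^bsub>loc_module R S M\<^esub>
        frac_cl (regular_module R) S f \<one> \<odot>\<^bsub>loc_module R S M\<^esub> frac_cl M S x t"
      unfolding loc_sub_def loc_module_carrier by blast
    then have "Y = frac_cl M S (t \<odot>\<^bsub>M\<^esub> n \<oplus>\<^bsub>M\<^esub> f \<odot>\<^bsub>M\<^esub> (s \<odot>\<^bsub>M\<^esub> x)) (s \<otimes> t)"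
      using c by (simp add: loc_module_smult loc_module_add smult_smult_comm[of s f])
    moreover have "t \<odot>\<^bsub>M\<^esub> n \<oplus>\<^bsub>M\<^esub> f \<odot>\<^bsub>M\<^esub> (s \<odot>\<^bsub>M\<^esub> x) \<in> ?T"
      using * submoduleE(4)[OF N S_carrier *(1)] smult_closed[OF S_carrier] by blast
    ultimately show "Y \<in> loc_sub ?T"
      unfolding loc_sub_def using m_closed[OF *(2,4)] by blast
  next
    fix Y assume "Y \<in> loc_sub ?T"
    then obtain n s x where *: "n \<in> N" "s \<in> S" "x \<in> carrier M"
      "Y = frac_cl M S (n \<oplus>\<^bsub>M\<^esub> f \<odot>\<^bsub>M\<^esub> x) s"
      unfolding loc_sub_def by blast
    have "Y = frac_cl M S n s \<oplus>\<^bsub>loc_module R S M\<^esub>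
        frac_cl (regular_module R) S f \<one> \<odot>\<^bsub>loc_module R S M\<^esub> frac_cl M S x s"
      unfolding *(4) using * c
      by (simp add: loc_module_smult loc_module_add)
        (rule frac_cl_eqI, auto simp: smult_r_distr smult_assoc1)
    moreover have "frac_cl M S n s \<in> loc_sub N" using * unfolding loc_sub_def by blast
    moreover have "frac_cl M S x s \<in> carrier (loc_module R S M)"
      using * unfolding loc_module_carrier by blast
    ultimately show "Y \<in> ?U" by blast
  qed
  moreover have "submodule ?T R M" using N f by (rule submodule_add_image)
  ultimately show ?case using Cons.IH[of ?T] Cons.prems(2) by simp
qed simp

lemma loc_sub_zero: "loc_sub {\<zero>\<^bsub>M\<^esub>} = {\<zero>\<^bsub>loc_module R S M\<^esub>}"
proof -
  have "frac_cl M S \<zero>\<^bsub>M\<^esub> s = \<zero>\<^bsub>loc_module R S M\<^esub>" if "s \<in> S" for s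
    unfolding loc_module_zero using that by (intro frac_cl_eqI) (auto simp: S_carrier)
  then have "loc_sub {\<zero>\<^bsub>M\<^esub>} = (\<lambda>s. \<zero>\<^bsub>loc_module R S M\<^esub>) ` S" by (auto simp: loc_sub_def image_iff)
  then show ?thesis using image_constant[OF one_closed] by simp
qed

end

context module
begin

text \<open>Over the localized ring the elementwise criterion speaks about \<open>loc_sub\<close>,
  and membership of a fraction there depends only on the numerator and \<open>sat\<close>. The
  denominators thus drop out.\<close>

lemma strongly_regular_seq_at_iff:
  assumes P: "primeideal P R" and fs: "set fs \<subseteq> carrier R"
  shows "strongly_regular_seq (ring_at R P) (module_at R M P) (map (to_ring_at R P) fs) \<longleftrightarrow>
    regular P {\<zero>\<^bsub>M\<^esub>} fs"
proof -
  let ?S = "carrier R - P"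
  interpret L: localization R M ?S
    using module_axioms primeideal_submonoid[OF P] by (simp add: localization_def)
  interpret A: module "loc_ring R ?S" "loc_module R ?S M" by (rule L.loc_module_module)
  let ?f = "\<lambda>f. frac_cl (regular_module R) ?S f \<one>"
  have f: "?f a \<in> carrier (loc_ring R ?S)" if "a \<in> carrier R" for a
    using that L.one_closed unfolding L.loc_ring_carrier by blast
  have t: "set (take i fs) \<subseteq> carrier R" for i using fs set_take_subset[of i fs] by blast
  let ?N = "\<lambda>i. seq_sub M {\<zero>\<^bsub>M\<^esub>} (take i fs)"
  have N: "submodule (?N i) R M" for i by (rule seq_sub_submodule[OF zero_submodule t])
  have sub: "seq_sub (loc_module R ?S M) {\<zero>\<^bsub>loc_module R ?S M\<^esub>} (take i (map ?f fs)) = L.loc_sub (?N i)" for i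
    using L.seq_sub_loc_module[OF zero_submodule t] by (simp add: take_map L.loc_sub_zero)
  have mem: "frac_cl M ?S x s \<in> L.loc_sub (?N i) \<longleftrightarrow> x \<in> sat P (?N i)"
    if "x \<in> carrier M" "s \<in> ?S" for x s i
    using that by (simp add: L.frac_cl_mem_loc_sub_iff[OF N] sat_def)
  have "strongly_regular_seq (ring_at R P) (module_at R M P) (map (to_ring_at R P) fs) \<longleftrightarrow>
    (\<forall>i<length fs. \<forall>X\<in>carrier (loc_module R ?S M).
      ?f (fs ! i) \<odot>\<^bsub>loc_module R ?S M\<^esub> X \<in> L.loc_sub (?N i) \<longrightarrow> X \<in> L.loc_sub (?N i))"
    unfolding ring_at_def module_at_def to_ring_at_def
    using f fs by (subst A.strongly_regular_seq_iff) (auto simp: sub)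
  also have "\<dots> \<longleftrightarrow> (\<forall>i<length fs. nonzerodivisor P (?N i) (fs ! i))"
  proof (intro all_cong1 imp_cong refl)
    fix i assume "i < length fs"
    then have i: "fs ! i \<in> carrier R" using fs by auto
    have "?f (fs ! i) \<odot>\<^bsub>loc_module R ?S M\<^esub> frac_cl M ?S x s \<in> L.loc_sub (?N i) \<longleftrightarrow>
      fs ! i \<odot>\<^bsub>M\<^esub> x \<in> sat P (?N i)" if "x \<in> carrier M" "s \<in> ?S" for x s
      using that i L.one_closed by (simp add: L.loc_module_smult mem)
    then show "(\<forall>X\<in>carrier (loc_module R ?S M). ?f (fs ! i) \<odot>\<^bsub>loc_module R ?S M\<^esub> X \<in> L.loc_sub (?N i)
        \<longrightarrow> X \<in> L.loc_sub (?N i)) \<longleftrightarrow> nonzerodivisor P (?N i) (fs ! i)"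
      unfolding nonzerodivisor_def L.loc_module_carrier using mem L.one_closed by blast
  qed
  also have "\<dots> \<longleftrightarrow> regular P {\<zero>\<^bsub>M\<^esub>} fs" by (simp add: regular_iff_nth)
  finally show ?thesis .
qed

text \<open>The inclusion of supports enters twice: at the given \<open>P\<close>, to make
  \<open>fs\<close> regular there, and at unspecified primes, to obtain the powers.\<close>

theorem regular_seq_Supp_mono:
  assumes R: "noetherian_ring R" and fg: "fin_gen_module R M"
    and fs: "set fs \<subseteq> carrier R" and gs: "set gs \<subseteq> carrier R" and len: "length fs = length gs"
    and Supp: "Supp R (quot_by_seq R M gs) \<subseteq> Supp R (quot_by_seq R M fs)"
    and reg: "regular_seq R M fs"
  shows "regular_seq R M gs"
  unfolding regular_seq_def
proof
  fix P assume Pg: "P \<in> Supp R (quot_by_seq R M gs)"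
  then have Pf: "P \<in> Supp R (quot_by_seq R M fs)" using Supp by blast
  have P: "primeideal P R" using Pg by (simp add: Supp_def)
  have regP: "regular P {\<zero>\<^bsub>M\<^esub>} fs"
    using reg Pf strongly_regular_seq_at_iff[OF P fs] by (simp add: regular_seq_def)
  have "regular P {\<zero>\<^bsub>M\<^esub>} gs"
  proof (rule regular_exchange[OF R fg P zero_submodule len _ _ regP])
    show "set fs \<subseteq> P" by (rule Supp_quot_by_seq_subset[OF fs Pf])
    show "set gs \<subseteq> P" by (rule Supp_quot_by_seq_subset[OF gs Pg])
    fix f x assume "f \<in> set fs" "x \<in> carrier M"
    then show "\<exists>k::nat. (f [^] k) \<odot>\<^bsub>M\<^esub> x \<in> sat P (seq_sub M {\<zero>\<^bsub>M\<^esub>} gs)"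
      using Supp_subset_imp_power_mem[OF R fs gs Supp]
        sat_superset[OF P seq_sub_submodule[OF zero_submodule gs]] by blast
  qed
  then show "strongly_regular_seq (ring_at R P) (module_at R M P) (map (to_ring_at R P) gs)"
    by (simp add: strongly_regular_seq_at_iff[OF P gs])
qed

end

section \<open>The ring as a module over itself\<close>

lemma (in cring) regular_module_fin_gen: "fin_gen_module R (regular_module R)"
proof -
  interpret M: module R "regular_module R" by (rule regular_module_module[OF is_cring])
  have G: "submodule (M.gen {\<one>}) R (regular_module R)" by (rule M.gen_submodule_submodule) simp
  have "a \<in> M.gen {\<one>}" if "a \<in> carrier R" for a
    using M.submoduleE(4)[OF G that, of \<one>] M.gen_superset[of "{\<one>}"] that by simp
  then have "M.gen {\<one>} = carrier (regular_module R)" using M.submoduleE(1)[OF G] by auto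
  then show ?thesis unfolding fin_gen_module_def by (intro exI[of _ "{\<one>}"]) simp
qed

text \<open>A prime containing \<open>fs\<close> contains the whole submodule they generate, and no
  element outside the prime carries \<open>\<one>\<close> into it; so the class of
  \<open>\<one>\<close> survives.\<close>

lemma (in cring) Supp_quot_regular_module:
  assumes fs: "set fs \<subseteq> carrier R"
  shows "Supp R (quot_by_seq R (regular_module R) fs) = zero_locus R fs"
proof (rule subset_antisym; rule subsetI)
  interpret M: module R "regular_module R" by (rule regular_module_module[OF is_cring])
  fix P
  {
    assume "P \<in> Supp R (quot_by_seq R (regular_module R) fs)"
    then show "P \<in> zero_locus R fs"
      using M.Supp_quot_by_seq_subset[OF fs] by (simp add: zero_locus_def Supp_def)
  next
    assume "P \<in> zero_locus R fs"
    then have P: "primeideal P R" "set fs \<subseteq> P" by (auto simp: zero_locus_def)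
    interpret P: primeideal P R by (rule P(1))
    \<comment> \<open>Negation in \<open>regular_module R\<close> is formed from a different record
      than in \<open>R\<close>; scalar multiplication by \<open>\<ominus> \<one>\<close> connects
      the two.\<close>
    have "\<ominus>\<^bsub>regular_module R\<^esub> a \<in> P" if "a \<in> P" for a
      using M.smult_l_minus[of \<one> a] P.I_l_closed[OF that, of "\<ominus> \<one>"] P.Icarr[OF that] by simp
    then have "submodule P R (regular_module R)"
      using P.a_subset P.I_l_closed by (intro M.submoduleI) auto
    then have "seq_sub (regular_module R) {\<zero>} fs \<subseteq> P"
      using M.seq_sub_least[of P "{\<zero>}" fs] P(2) P.I_r_closed by auto
    then have "\<one> \<notin> M.sat P (seq_sub (regular_module R) {\<zero>} fs)" by (auto simp: M.sat_def)
    then show "P \<in> Supp R (quot_by_seq R (regular_module R) fs)"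
      using P(1) M.mem_Supp_quot_by_seq_iff[OF fs] by auto
  }
qed

theorem corollary2:
  fixes R :: "('a, 'm) ring_scheme" and M :: "('a, 'b, 'n) module_scheme" and fs gs :: "'a list"
  assumes "cring R" and "noetherian_ring R"
    and "set fs \<subseteq> carrier R" and "set gs \<subseteq> carrier R" and "length fs = length gs"
  shows "(module R M \<and> fin_gen_module R M
            \<and> Supp R (quot_by_seq R M gs) \<subseteq> Supp R (quot_by_seq R M fs)
            \<and> regular_seq R M fs
          \<longrightarrow> regular_seq R M gs)
       \<and> (zero_locus R gs \<subseteq> zero_locus R fs \<and> regular_seq R (regular_module R) fs
          \<longrightarrow> regular_seq R (regular_module R) gs)"
proof (intro conjI impI; elim conjE)
  assume "module R M" "fin_gen_module R M"
    "Supp R (quot_by_seq R M gs) \<subseteq> Supp R (quot_by_seq R M fs)" "regular_seq R M fs"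
  then show "regular_seq R M gs" using module.regular_seq_Supp_mono assms by blast
next
  assume "zero_locus R gs \<subseteq> zero_locus R fs" "regular_seq R (regular_module R) fs"
  then show "regular_seq R (regular_module R) gs"
    using module.regular_seq_Supp_mono[OF regular_module_module[OF assms(1)] assms(2)
        cring.regular_module_fin_gen[OF assms(1)] assms(3-5)]
    by (simp add: cring.Supp_quot_regular_module assms)
qed

end
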